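(* Let $0\le p\le q$ be integers, let $a_1,\ldots,a_p>0$ and $b_1,\ldots,b_q>0$, put $r=q-p$, and suppose that $$\frac{e_q(b_1,\ldots,b_q)}{e_{p}(a_1,\ldots,a_{p})}\le\frac{e_{q-1}(b_1,\ldots,b_q)}{e_{p-1}(a_1,\ldots,a_{p})}\le\cdots\le\frac{e_{r+1}(b_1,\ldots,b_q)}{e_{1}(a_1,\ldots,a_{p})}\le e_{r}(b_1,\ldots,b_q)$$ (no condition if $p=0$). Denote $$f(\nu,x):=\frac{1}{\Gamma(\nu)}\,{}_pF_{q+1}(a_1,\ldots,a_p;\nu,b_1,\ldots,b_q;x).$$ Then: (1) for each fixed $x\ge0$ the function $\nu\mapsto f(\nu,x)$ is strictly log-concave on $(0,\infty)$. Moreover, for all real $\mu,\alpha,\beta$ with $\mu\ge-1$, $\alpha,\beta>0$, $\mu+\alpha\ge0$, $\mu+\beta\ge0$, setting $\varphi_{\alpha,\beta,\mu}(x):=f(\alpha+\mu,x)f(\beta+\mu,x)-f(\alpha+\beta+\mu,x)f(\mu,x)$: (2) all power series coefficients of $\varphi_{\alpha,\beta,\mu}$ in powers of $x$ are positive, so that $\varphi_{\alpha,\beta,\mu}$ is absolutely monotonic and multiplicatively convex on $(0,\infty)$; (3) $y\mapsto\varphi_{\alpha,\beta,\mu}(1/y)$ is completely monotonic and log-convex on $(0,\infty)$, so that there exists a non-negative measure $\tau$ supported on $[0,\infty)$ such that $\varphi_{\alpha,\beta,\mu}(x)=\int_{[0,\infty)}e^{-t/x}\,d\tau(t)$ for $x>0$;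 (4) with the convention $\Gamma(-1)=-\infty$, $\Gamma(0)=+\infty$, $$\frac{\Gamma(\alpha+\mu)\Gamma(\beta+\mu)}{\Gamma(\mu)\Gamma(\alpha+\beta+\mu)}<\frac{f(\mu,x)f(\alpha+\beta+\mu,x)}{f(\alpha+\mu,x)f(\beta+\mu,x)}<1\quad\text{for all }x\ge0,$$ where if $\mu=0$ or $\mu=-1$ it is additionally required that $x\ne0$ (otherwise the left inequality becomes equality); (5) for all $x\ge0$, $$f(\alpha+\mu,x)f(\beta+\mu,x)-f(\alpha+\beta+\mu,x)f(\mu,x)\ge\frac{1}{\Gamma(\mu+\alpha)\Gamma(\mu+\beta)}-\frac{1}{\Gamma(\mu)\Gamma(\mu+\alpha+\beta)},$$ with equality only at $x=0$.
   Context: $\Gamma$ is Euler's gamma function; $1/\Gamma$ is regarded as an entire function (equal to $0$ at $0,-1,-2,\ldots$). $(a)_0=1$, $(a)_n=a(a+1)\cdots(a+n-1)$. $e_k(x_1,\ldots,x_q)$ is the $k$-th elementary symmetric polynomial, $e_0=1$. The generalized hypergeometric function is ${}_pF_q(a_1,\ldots,a_p;b_1,\ldots,b_q;z)=\sum_{n\ge0}\frac{(a_1)_n\cdots(a_p)_n}{(b_1)_n\cdots(b_q)_n n!}z^n$; thus $f(\nu,x)=\sum_{n\ge0}\frac{(a_1)_n\cdots(a_p)_n}{(b_1)_n\cdots(b_q)_n}\frac{x^n}{n!\,\Gamma(\nu+n)}$, which also defines $f(\nu,x)$ when $\nu$ is a non-positive integer. A positive continuous function $F$ on an interval $I$ is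 strictly log-concave if $F(\mu+h)^2>F(\mu)F(\mu+2h)$ for all $h>0$ and $[\mu,\mu+2h]\subseteq I$; log-convex means that $\log F$ is convex. Absolutely monotonic: the function and all its derivatives are non-negative. Completely monotonic on $(0,\infty)$: $(-1)^nF^{(n)}\ge0$ for all $n\ge0$. Multiplicatively convex on $(0,\infty)$: $\varphi(x^{\lambda}y^{1-\lambda})\le\varphi(x)^{\lambda}\varphi(y)^{1-\lambda}$ for all $x,y>0$, $\lambda\in[0,1]$.
   Formalization: In (2) the coefficient of x^0 is 0 if μ=-1 and α=1 or β=1, and that of x^1 is 0 if α=β=-μ; all others are positive. In (4) the left inequality is strict for x>0 and an equality at x=0 for every μ; indeterminate quotients at poles of Γ (μ=-1, α=1 or β=1) are read as 0. *)

theory Defs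
  imports "HOL-Analysis.Analysis"
begin

text \<open>Parameter tuples are lists; indexing the subsets by positions makes repeated entries
  contribute with their multiplicity.\<close>

definition elem_sym :: "nat \<Rightarrow> real list \<Rightarrow> real" where
  "elem_sym k xs = (\<Sum>S | S \<subseteq> {..<length xs} \<and> card S = k. \<Prod>i\<in>S. xs ! i)"

definition poch_quot :: "real list \<Rightarrow> real list \<Rightarrow> nat \<Rightarrow> real" where
  "poch_quot a b n = (\<Prod>u\<leftarrow>a. pochhammer u n) / (\<Prod>u\<leftarrow>b. pochhammer u n)"

definition hypergeom :: "real list \<Rightarrow> real list \<Rightarrow> real \<Rightarrow> real" where
  "hypergeom a b z = (\<Sum>n. poch_quot a b n * z ^ n / fact n)"

text \<open>The library's \<open>rGamma\<close> is the entire function \<open>1/\<Gamma>\<close>, so this series also makes sense for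
  non-positive integers \<open>\<nu>\<close>. For the other \<open>\<nu>\<close> it is \<open>1/\<Gamma>(\<nu>)\<close> times the hypergeometric function
  with the additional lower parameter \<open>\<nu>\<close>; see \<open>hyp_rGamma_eq_hypergeom\<close> below.\<close>

definition hyp_rGamma :: "real list \<Rightarrow> real list \<Rightarrow> real \<Rightarrow> real \<Rightarrow> real" where
  "hyp_rGamma a b \<nu> x = (\<Sum>n. poch_quot a b n * x ^ n / fact n * rGamma (\<nu> + real n))"

text \<open>The coefficient of \<open>x ^ 0\<close> in \<open>phi\<close> is
  \<open>1/(\<Gamma>(\<alpha>+\<mu>) \<Gamma>(\<beta>+\<mu>)) - 1/(\<Gamma>(\<mu>) \<Gamma>(\<alpha>+\<beta>+\<mu>))\<close>, which vanishes for \<open>\<mu> = -1\<close> and \<open>\<alpha> = 1\<close> or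
  \<open>\<beta> = 1\<close>. The coefficient of \<open>x ^ 1\<close> contains the factor \<open>\<alpha> + \<beta> + 2\<mu>\<close>, which vanishes for
  \<open>\<alpha> = \<beta> = -\<mu>\<close>. In these boundary cases that coefficient is not strictly positive.\<close>

definition phi :: "real list \<Rightarrow> real list \<Rightarrow> real \<Rightarrow> real \<Rightarrow> real \<Rightarrow> real \<Rightarrow> real" where
  "phi a b \<alpha> \<beta> \<mu> x =
     hyp_rGamma a b (\<alpha> + \<mu>) x * hyp_rGamma a b (\<beta> + \<mu>) x
     - hyp_rGamma a b (\<alpha> + \<beta> + \<mu>) x * hyp_rGamma a b \<mu> x"

text \<open>The values at the poles \<open>0\<close> and \<open>-1\<close> are a convention. Extended real division is
  multiplication by the inverse, with \<open>inverse (\<plusminus>\<infinity>) = 0\<close>, \<open>inverse 0 = \<infinity>\<close> and \<open>0 * \<infinity> = 0\<close>.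
  Quotients of these values therefore agree with \<open>1/\<Gamma> = 0\<close> at the poles, and with
  \<open>\<infinity> / -\<infinity> = 0\<close>. A quotient of products of \<open>hyp_rGamma\<close> values has denominator \<open>0\<close> only at \<open>x = 0\<close>, when
  \<open>\<alpha> + \<mu> = 0\<close> or \<open>\<beta> + \<mu> = 0\<close>; there extended real division gives the same value as the quotient
  of the Gamma values (\<open>-\<infinity>\<close> if \<open>-1 < \<mu> < 0\<close>, and \<open>0\<close> if \<open>\<mu> = -1\<close>).\<close>

definition Gamma_ext :: "real \<Rightarrow> ereal" where
  "Gamma_ext z = (if z = 0 then \<infinity> else if z = -1 then -\<infinity> else ereal (Gamma z))"

definition strictly_log_concave_on :: "real set \<Rightarrow> (real \<Rightarrow> real) \<Rightarrow> bool" where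
  "strictly_log_concave_on I F \<longleftrightarrow>
     continuous_on I F \<and> (\<forall>x\<in>I. 0 < F x) \<and>
     (\<forall>\<mu> h. 0 < h \<longrightarrow> {\<mu>..\<mu> + 2 * h} \<subseteq> I \<longrightarrow> F \<mu> * F (\<mu> + 2 * h) < (F (\<mu> + h))\<^sup>2)"

definition log_convex_on :: "real set \<Rightarrow> (real \<Rightarrow> real) \<Rightarrow> bool" where
  "log_convex_on I F \<longleftrightarrow> (\<forall>x\<in>I. 0 < F x) \<and> convex_on I (\<lambda>x. ln (F x))"

text \<open>The next two notions are meant for open sets \<open>I\<close>: derivatives are two-sided, and their
  existence to all orders is part of the definition because \<open>deriv\<close> is total.\<close>

definition absolutely_monotonic_on :: "real set \<Rightarrow> (real \<Rightarrow> real) \<Rightarrow> bool" where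
  "absolutely_monotonic_on I F \<longleftrightarrow>
     (\<forall>n. \<forall>x\<in>I. (deriv ^^ n) F differentiable (at x) \<and> 0 \<le> (deriv ^^ n) F x)"

definition completely_monotonic_on :: "real set \<Rightarrow> (real \<Rightarrow> real) \<Rightarrow> bool" where
  "completely_monotonic_on I F \<longleftrightarrow>
     (\<forall>n. \<forall>x\<in>I. (deriv ^^ n) F differentiable (at x) \<and> 0 \<le> (-1) ^ n * (deriv ^^ n) F x)"

definition multiplicatively_convex :: "(real \<Rightarrow> real) \<Rightarrow> bool" where
  "multiplicatively_convex F \<longleftrightarrow>
     (\<forall>x>0. \<forall>y>0. \<forall>l\<in>{0..1}.
        F (x powr l * y powr (1 - l)) \<le> F x powr l * F y powr (1 - l))"

lemma poch_quot_Suc: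
  "poch_quot a b (Suc n) = poch_quot a b n * ((\<Prod>u\<leftarrow>a. u + real n) / (\<Prod>u\<leftarrow>b. u + real n))"
proof -
  have "(\<Prod>u\<leftarrow>c. pochhammer u (Suc n)) = (\<Prod>u\<leftarrow>c. pochhammer u n) * (\<Prod>u\<leftarrow>c. u + real n)"
    for c :: "real list"
    by (induction c) (auto simp: pochhammer_Suc)
  then show ?thesis
    by (simp add: poch_quot_def)
qed

lemma poch_quot_ratio_bounded:
  fixes a b :: "real list"
  assumes "length a \<le> length b" "\<forall>u\<in>set a. 0 < u" "\<forall>u\<in>set b. 0 < u"
  shows "\<exists>C>0. \<forall>n. (\<Prod>u\<leftarrow>a. u + real n) \<le> C * (\<Prod>u\<leftarrow>b. u + real n)"
  using assms
proof (induction b arbitrary: a)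
  case Nil
  then show ?case by (auto intro!: exI[of _ 1])
next
  case (Cons v b)
  have pos: "0 \<le> (\<Prod>u\<leftarrow>c. u + real n)" if "\<forall>u\<in>set c. 0 < u" for c :: "real list" and n
    using that by (induction c) auto
  have v: "0 < v" using Cons.prems by simp
  show ?case
  proof (cases a)
    case Nil
    have "\<exists>C>0. \<forall>n. (\<Prod>u\<leftarrow>[]. u + real n) \<le> C * (\<Prod>u\<leftarrow>b. u + real n)"
      using Cons.prems by (intro Cons.IH) auto
    then obtain C where C: "C > 0" "\<And>n. 1 \<le> C * (\<Prod>u\<leftarrow>b. u + real n)" by auto
    have "1 \<le> C / v * (\<Prod>u\<leftarrow>v # b. u + real n)" for n
    proof -
      have "1 * 1 \<le> ((v + real n) / v) * (C * (\<Prod>u\<leftarrow>b. u + real n))"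
        using v C(2)[of n] by (intro mult_mono) auto
      then show ?thesis by (simp add: field_simps)
    qed
    then show ?thesis using Nil C(1) v by (intro exI[of _ "C / v"]) auto
  next
    case (Cons w c)
    have "\<exists>C>0. \<forall>n. (\<Prod>u\<leftarrow>c. u + real n) \<le> C * (\<Prod>u\<leftarrow>b. u + real n)"
      using Cons.prems Cons by (intro Cons.IH) auto
    then obtain C where C: "C > 0" "\<And>n. (\<Prod>u\<leftarrow>c. u + real n) \<le> C * (\<Prod>u\<leftarrow>b. u + real n)" by auto
    have w: "0 < w" and c: "\<forall>u\<in>set c. 0 < u" using Cons Cons.prems by auto
    have "(\<Prod>u\<leftarrow>w # c. u + real n) \<le> ((1 + w / v) * C) * (\<Prod>u\<leftarrow>v # b. u + real n)" for n
    proof -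
      have "w + real n \<le> (1 + w / v) * (v + real n)"
        using v w by (simp add: field_simps)
      then have "(w + real n) * (\<Prod>u\<leftarrow>c. u + real n)
          \<le> ((1 + w / v) * (v + real n)) * (C * (\<Prod>u\<leftarrow>b. u + real n))"
        using v w C(2)[of n] pos[OF c, of n] by (intro mult_mono) auto
      then show ?thesis by (simp add: mult_ac)
    qed
    then show ?thesis using Cons C(1) v w by (intro exI[of _ "(1 + w / v) * C"]) (auto intro!: mult_pos_pos add_pos_pos)
  qed
qed

lemma summable_hypergeom:
  fixes a b :: "real list" and \<nu> z :: real
  assumes "length a \<le> length b" "\<forall>u\<in>set a. 0 < u" "\<forall>u\<in>set b. 0 < u"
  shows "summable (\<lambda>n. poch_quot a (\<nu> # b) n * z ^ n / fact n)"
proof -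
  obtain C where C: "C > 0" "\<And>n. (\<Prod>u\<leftarrow>a. u + real n) \<le> C * (\<Prod>u\<leftarrow>b. u + real n)"
    using poch_quot_ratio_bounded[OF assms] by blast
  have pos: "0 < (\<Prod>u\<leftarrow>c. u + real n)" if "\<forall>u\<in>set c. 0 < u" for c :: "real list" and n
    using that by (induction c) (auto intro!: mult_pos_pos add_pos_nonneg)
  define K where "K = C * \<bar>z\<bar>"
  obtain N :: nat where N: "real N > max (1 - \<nu>) (2 * K)"
    using reals_Archimedean2 by blast
  let ?t = "\<lambda>n. poch_quot a (\<nu> # b) n * z ^ n / fact n"
  show ?thesis
  proof (rule summable_ratio_test[of "1/2" N ?t])
    fix n assume n: "N \<le> n"
    let ?A = "\<Prod>u\<leftarrow>a. u + real n" and ?B = "\<Prod>u\<leftarrow>b. u + real n"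
    have "real N \<le> real n" using n by simp
    with N have n1: "\<nu> + real n \<ge> 1" and "2 * K \<le> real n + 1" by linarith+
    then have n2: "C * \<bar>z\<bar> \<le> 1/2 * (real n + 1)" by (simp add: K_def)
    have A: "0 < ?A" and B: "0 < ?B" using pos assms by blast+
    have "?A / ((\<nu> + real n) * ?B) \<le> ?A / (1 * ?B)"
      using A B n1 by (intro divide_left_mono mult_right_mono mult_pos_pos) auto
    also have "\<dots> \<le> C" using C(2)[of n] B by (simp add: field_simps)
    finally have "?A / ((\<nu> + real n) * ?B) * \<bar>z\<bar> \<le> C * \<bar>z\<bar>" by (intro mult_right_mono) auto
    then have q: "?A / ((\<nu> + real n) * ?B) * \<bar>z\<bar> / (real n + 1) \<le> 1/2"
    proof -
      have "?A / ((\<nu> + real n) * ?B) * \<bar>z\<bar> \<le> 1/2 * (real n + 1)"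
        using \<open>?A / ((\<nu> + real n) * ?B) * \<bar>z\<bar> \<le> C * \<bar>z\<bar>\<close> n2 by (rule order.trans)
      then show ?thesis by (subst pos_divide_le_eq) auto
    qed
    have "?t (Suc n) = ?t n * (?A / ((\<nu> + real n) * ?B) * z / (real n + 1))"
      by (simp add: poch_quot_Suc field_simps)
    then have "norm (?t (Suc n)) = norm (?t n) * (?A / ((\<nu> + real n) * ?B) * \<bar>z\<bar> / (real n + 1))"
      using A B n1 by (simp add: abs_mult)
    also have "\<dots> \<le> norm (?t n) * (1/2)" using q by (intro mult_left_mono) auto
    finally show "norm (?t (Suc n)) \<le> 1/2 * norm (?t n)" by simp
  qed simp
qed

lemma hyp_rGamma_eq_hypergeom:
  fixes a b :: "real list" and \<nu> x :: real
  assumes "length a \<le> length b" "\<forall>u\<in>set a. 0 < u" "\<forall>u\<in>set b. 0 < u" "\<nu> \<notin> \<int>\<^sub>\<le>\<^sub>0"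
  shows "hyp_rGamma a b \<nu> x = 1 / Gamma \<nu> * hypergeom a (\<nu> # b) x"
proof -
  have "poch_quot a b n * x ^ n / fact n * rGamma (\<nu> + real n)
      = 1 / Gamma \<nu> * (poch_quot a (\<nu> # b) n * x ^ n / fact n)" for n
  proof -
    have "pochhammer \<nu> n \<noteq> 0"
      using assms(4) by (auto simp: pochhammer_eq_0_iff)
    moreover have "rGamma \<nu> = pochhammer \<nu> n * rGamma (\<nu> + real n)"
      using pochhammer_rGamma[of \<nu> n] by simp
    ultimately show ?thesis
      by (simp add: poch_quot_def rGamma_inverse_Gamma[symmetric] divide_inverse)
  qed
  then show ?thesis
    using suminf_mult[OF summable_hypergeom[OF assms(1-3), of \<nu> x], of "1 / Gamma \<nu>"]
    by (simp add: hyp_rGamma_def hypergeom_def)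
qed

end

theory Submission
  imports Defs "HOL-Probability.Distributions"
begin

text \<open>Write \<open>f n\<close> for the Pochhammer quotients. The condition on the elementary symmetric polynomials
  says that the coefficient ratios of \<open>\<Prod>(b\<^sub>i + x)\<close> and \<open>\<Prod>(a\<^sub>i + x)\<close> increase, so
  \<open>f (n+1) / f n\<close> decreases and \<open>f k * f (m-k)\<close> increases for \<open>k \<le> m/2\<close>.
  The \<open>m\<close>-th coefficient of \<open>phi\<close> is, after symmetrization, a sum of these weights times
  differences \<open>M k\<close> of products of reciprocal Gamma values. A monotone ratio shows that
  \<open>M k\<close> changes sign at most once on \<open>k \<le> m/2\<close>, from negative to positive, and the sum of the
  \<open>M k\<close> is evaluated by Vandermonde's identity; it is positive because
  \<open>Gamma\<close> is strictly log-convex. Hence the coefficients are positive.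

  The remaining claims follow from nonnegative coefficients: Hoelder's inequality gives both
  convexity statements, and the representing measure comes from \<open>x ^ Suc k = \<integral> t ^ k / k! * exp (-t/x) dt\<close>.
  The lower bound on the quotient for \<open>\<mu> > 0\<close> is log-convexity of the hypergeometric
  function in a lower parameter, again by Hoelder; for \<open>-1 < \<mu> < 0\<close> the sign of
  \<open>pochhammer \<mu> n\<close> is negative for \<open>n \<ge> 1\<close>, so the function with parameter \<open>\<mu>\<close> is at most \<open>1\<close>.\<close>

subsection \<open>Log-concavity of Pochhammer quotients\<close>

text \<open>Expanding the product chooses a set \<open>S\<close> of positions that contribute
  entries; the others contribute \<open>x\<close>, and the sets are grouped by cardinality.\<close>

lemma prod_list_add_eq_sum_elem_sym:
  "(\<Prod>u\<leftarrow>xs. u + x) = (\<Sum>j\<le>length xs. elem_sym (length xs - j) xs * x ^ j)"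
proof -
  let ?n = "length xs"
  have "(\<Prod>u\<leftarrow>xs. u + x) = (\<Prod>i<?n. xs ! i + x)"
    by (simp add: prod.list_conv_set_nth atLeast0LessThan)
  also have "\<dots> = (\<Sum>S\<in>Pow {..<?n}. (\<Prod>i\<in>S. xs ! i) * x ^ (?n - card S))"
    by (subst prod_add) (auto intro!: sum.cong simp: card_Diff_subset finite_subset)
  also have "\<dots> = (\<Sum>k\<le>?n. \<Sum>S | S \<in> Pow {..<?n} \<and> card S = k. (\<Prod>i\<in>S. xs ! i) * x ^ (?n - card S))"
  proof (rule sum.group[symmetric])
    show "card ` Pow {..<?n} \<subseteq> {..?n}"
      using card_mono[of "{..<?n}"] by auto
  qed auto
  also have "\<dots> = (\<Sum>k\<le>?n. elem_sym k xs * x ^ (?n - k))"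
    unfolding elem_sym_def sum_distrib_right by (intro sum.cong refl) auto
  also have "\<dots> = (\<Sum>j\<le>?n. elem_sym (?n - j) xs * x ^ j)"
    by (rule sum.reindex_bij_witness[of _ "\<lambda>j. ?n - j" "\<lambda>j. ?n - j"]) auto
  finally show ?thesis .
qed

lemma elem_sym_nonneg: "\<forall>u\<in>set xs. 0 < u \<Longrightarrow> 0 \<le> elem_sym k xs"
  unfolding elem_sym_def by (intro sum_nonneg prod_nonneg) (force simp: less_imp_le)

lemma elem_sym_pos:
  assumes "\<forall>u\<in>set xs. 0 < u" "k \<le> length xs"
  shows "0 < elem_sym k xs"
proof -
  have fin: "finite {S. S \<subseteq> {..<length xs} \<and> card S = k}"
    by (rule finite_subset[of _ "Pow {..<length xs}"]) auto
  have "{..<k} \<in> {S. S \<subseteq> {..<length xs} \<and> card S = k}" using assms(2) by auto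
  then show ?thesis
    unfolding elem_sym_def using fin assms(1)
    by (intro sum_pos prod_pos) (auto intro!: exI[of _ "{..<k}"])
qed

text \<open>After symmetrizing the double sum in \<open>i\<close> and \<open>j\<close>, every summand has the right sign.\<close>

lemma polynomial_quotient_mono:
  fixes a b :: "nat \<Rightarrow> real"
  assumes "\<And>i j. i \<le> j \<Longrightarrow> j \<le> N \<Longrightarrow> a j * b i \<le> a i * b j" "0 \<le> x" "x \<le> y"
  shows "(\<Sum>i\<le>N. a i * y ^ i) * (\<Sum>j\<le>N. b j * x ^ j) \<le> (\<Sum>i\<le>N. a i * x ^ i) * (\<Sum>j\<le>N. b j * y ^ j)"
proof -
  let ?D = "\<lambda>i j. a i * b j * (x ^ i * y ^ j - y ^ i * x ^ j)"
  define S where "S = (\<Sum>i\<le>N. \<Sum>j\<le>N. ?D i j)"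
  have pow: "y ^ i * x ^ j \<le> x ^ i * y ^ j" if "i \<le> j" for i j
  proof -
    have "x ^ i * y ^ i * x ^ (j - i) \<le> x ^ i * y ^ i * y ^ (j - i)"
      using assms(2,3) by (intro mult_left_mono power_mono) auto
    moreover have "x ^ j = x ^ i * x ^ (j - i)" "y ^ j = y ^ i * y ^ (j - i)"
      using that by (simp_all flip: power_add)
    ultimately show ?thesis by (simp add: mult_ac)
  qed
  have "S + S = S + (\<Sum>i\<le>N. \<Sum>j\<le>N. ?D j i)"
    unfolding S_def by (subst (3) sum.swap) simp
  also have "\<dots> = (\<Sum>i\<le>N. \<Sum>j\<le>N. (a i * b j - a j * b i) * (x ^ i * y ^ j - y ^ i * x ^ j))"
    unfolding S_def by (simp add: sum.distrib[symmetric] algebra_simps)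
  also have "\<dots> \<ge> 0"
  proof (intro sum_nonneg)
    fix i j assume "i \<in> {..N}" "j \<in> {..N}"
    show "0 \<le> (a i * b j - a j * b i) * (x ^ i * y ^ j - y ^ i * x ^ j)"
    proof (cases "i \<le> j")
      case True
      then show ?thesis using assms(1)[of i j] pow[of i j] \<open>j \<in> {..N}\<close> by (intro mult_nonneg_nonneg) auto
    next
      case False
      then show ?thesis using assms(1)[of j i] pow[of j i] \<open>i \<in> {..N}\<close>
        by (intro mult_nonpos_nonpos) (auto simp: mult_ac)
    qed
  qed
  finally have "0 \<le> S" by simp
  also have "S = (\<Sum>i\<le>N. a i * x ^ i) * (\<Sum>j\<le>N. b j * y ^ j) - (\<Sum>i\<le>N. a i * y ^ i) * (\<Sum>j\<le>N. b j * x ^ j)"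
    unfolding S_def sum_product by (simp add: sum_subtractf[symmetric] algebra_simps)
  finally show ?thesis by simp
qed

text \<open>Chaining the adjacent comparisons and reading them from the top index down shows that
  the coefficient quotients \<open>B j / A j\<close> of the two products increase with
  \<open>j\<close>, so \<open>polynomial_quotient_mono\<close> applies.\<close>

lemma elem_sym_quotient_mono:
  fixes a b :: "real list" and r :: nat
  assumes "r = length b - length a" "length a \<le> length b"
    and "\<forall>u\<in>set a. 0 < u" "\<forall>u\<in>set b. 0 < u"
    and "\<forall>k<length a. elem_sym (r + Suc k) b / elem_sym (Suc k) a \<le> elem_sym (r + k) b / elem_sym k a"
    and "0 \<le> x" "x \<le> y"
  shows "(\<Prod>u\<leftarrow>a. u + y) * (\<Prod>u\<leftarrow>b. u + x) \<le> (\<Prod>u\<leftarrow>a. u + x) * (\<Prod>u\<leftarrow>b. u + y)"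
proof -
  let ?p = "length a" and ?q = "length b"
  \<comment> \<open>Padding with zeros lets both sums run up to the larger degree; for
    \<open>j > ?p\<close> the comparison needed has left side \<open>0\<close>.\<close>
  define A where "A j = (if j \<le> ?p then elem_sym (?p - j) a else 0)" for j
  define B where "B j = elem_sym (?q - j) b" for j
  have a: "(\<Prod>u\<leftarrow>a. u + z) = (\<Sum>j\<le>?q. A j * z ^ j)" for z
    unfolding prod_list_add_eq_sum_elem_sym A_def
    by (rule sum.mono_neutral_cong_left) (use assms(2) in auto)
  have b: "(\<Prod>u\<leftarrow>b. u + z) = (\<Sum>j\<le>?q. B j * z ^ j)" for z
    unfolding prod_list_add_eq_sum_elem_sym B_def by simp
  have dec: "elem_sym (r + l) b / elem_sym l a \<le> elem_sym (r + k) b / elem_sym k a"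
    if "k \<le> l" "l \<le> ?p" for k l
    using that
  proof (induction l rule: dec_induct)
    case (step n)
    then show ?case using assms(5)[rule_format, of n] by (meson Suc_le_lessD Suc_leD order.trans)
  qed simp
  have "A j * B i \<le> A i * B j" if "i \<le> j" "j \<le> ?q" for i j
  proof (cases "j \<le> ?p")
    case True
    have "0 < elem_sym (?p - i) a" "0 < elem_sym (?p - j) a"
      using assms(3) by (auto intro: elem_sym_pos)
    moreover have "elem_sym (r + (?p - i)) b / elem_sym (?p - i) a \<le> elem_sym (r + (?p - j)) b / elem_sym (?p - j) a"
      using that True by (intro dec) auto
    moreover have "r + (?p - i) = ?q - i" "r + (?p - j) = ?q - j"
      using that True assms(1,2) by auto
    ultimately show ?thesis
      using that True by (simp add: A_def B_def field_simps)
  next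
    case False
    then show ?thesis using assms(3,4) by (auto simp: A_def B_def elem_sym_nonneg intro!: mult_nonneg_nonneg)
  qed
  then show ?thesis unfolding a b using assms(6,7) by (rule polynomial_quotient_mono)
qed

subsection \<open>Symmetrized products of reciprocal Gamma values\<close>

text \<open>Each factor of \<open>pochhammer (c + t) n / pochhammer (c - t) n\<close> grows with
  \<open>t\<close>. This supplies the growth of \<open>\<rho>\<close> in
  \<open>symmetric_ratio_mono\<close>.\<close>

lemma pochhammer_quotient_mono:
  fixes c t T :: real
  assumes "0 \<le> t" "t \<le> T" "T < c"
  shows "pochhammer (c + t) n * pochhammer (c - T) n \<le> pochhammer (c + T) n * pochhammer (c - t) n"
proof (induction n)
  case (Suc n)
  have "(c + t + n) * (c - T + n) \<le> (c + T + n) * (c - t + n)"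
  proof -
    have "(c + T + n) * (c - t + n) - (c + t + n) * (c - T + n) = 2 * (c + n) * (T - t)"
      by (simp add: algebra_simps)
    moreover have "0 \<le> 2 * (c + n) * (T - t)" using assms by (intro mult_nonneg_nonneg) auto
    ultimately show ?thesis by linarith
  qed
  from mult_mono[OF Suc this] show ?case
    using assms by (simp add: pochhammer_Suc mult_ac pochhammer_nonneg)
qed simp

text \<open>With \<open>p = (c+t)\<^sub>n\<close> and \<open>q = (c-t)\<^sub>n\<close> the left side is the quotient of \<open>rGamma_symm\<close> at
  neighbouring indices. It equals
  \<open>(u + v)/2 + (v - u)/2 * (\<rho> - 1)/(\<rho> + 1)\<close> with \<open>u = (c-1-t)/(F+t)\<close>, \<open>v = (c-1+t)/(F-t)\<close>,
  \<open>F = c + n\<close> and \<open>\<rho> = p/q\<close>; the terms \<open>u + v\<close>, \<open>v - u\<close> and \<open>\<rho>\<close> increase with \<open>t\<close>.\<close>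

lemma symmetric_ratio_mono:
  fixes c F t T p q P Q :: real
  assumes "1 \<le> c" "c \<le> F" "0 \<le> t" "t \<le> T" "T < c"
    and pos: "0 < p" "0 < q" "0 < P" "0 < Q" and "q \<le> p" "p * Q \<le> P * q"
  shows "(p * ((c - 1 + t) / (F - t)) + q * ((c - 1 - t) / (F + t))) / (p + q)
       \<le> (P * ((c - 1 + T) / (F - T)) + Q * ((c - 1 - T) / (F + T))) / (P + Q)"
proof -
  \<comment> \<open>\<open>h\<close> is \<open>(u + v)/2\<close> and \<open>d\<close> is
    \<open>(v - u)/2\<close>, as functions of the half-difference \<open>s\<close>.\<close>
  define h where "h s = ((c - 1) * F + s\<^sup>2) / (F\<^sup>2 - s\<^sup>2)" for s
  define d where "d s = s * (c - 1 + F) / (F\<^sup>2 - s\<^sup>2)" for s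
  have tT: "t\<^sup>2 \<le> T\<^sup>2" using assms by (intro power_mono) auto
  have TF: "T\<^sup>2 < F\<^sup>2" using assms by (intro power_strict_mono) auto
  have split: "(x * ((c - 1 + s) / (F - s)) + y * ((c - 1 - s) / (F + s))) / (x + y)
      = h s + d s * ((x - y) / (x + y))" if "0 \<le> s" "s \<le> T" "0 < x" "0 < y" for s x y
  proof -
    have s: "F - s \<noteq> 0" "F + s \<noteq> 0" "x + y \<noteq> 0" using that assms by auto
    have F: "F\<^sup>2 - s\<^sup>2 = (F - s) * (F + s)" by (simp add: power2_eq_square algebra_simps)
    show ?thesis unfolding h_def d_def F using s
      by (simp add: divide_simps) (simp add: algebra_simps power2_eq_square)
  qed
  have "h t \<le> h T" unfolding h_def
    using tT TF assms by (intro frac_le) auto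
  moreover have "d t \<le> d T" unfolding d_def
    using tT TF assms by (intro frac_le mult_right_mono) auto
  moreover have "0 \<le> d t" unfolding d_def using tT TF assms by auto
  moreover have "(p - q) / (p + q) \<le> (P - Q) / (P + Q)"
    using pos assms(11) by (simp add: divide_simps) (simp add: algebra_simps)
  moreover have "0 \<le> (p - q) / (p + q)" using pos assms(10) by simp
  ultimately have "h t + d t * ((p - q) / (p + q)) \<le> h T + d T * ((P - Q) / (P + Q))"
    by (intro add_mono mult_mono) auto
  then show ?thesis using assms by (subst (1 2) split) auto
qed

text \<open>Symmetrizing in \<open>i\<close> and \<open>j\<close> is free because the weight
  \<open>f i * f j\<close> is symmetric, and it leaves only the indices up to the middle to be
  studied.\<close>

definition rGamma_symm :: "real \<Rightarrow> real \<Rightarrow> nat \<Rightarrow> nat \<Rightarrow> real" where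
  "rGamma_symm A B i j = rGamma (A + real i) * rGamma (B + real j) + rGamma (A + real j) * rGamma (B + real i)"

lemma rGamma_real_pos: "0 < x \<Longrightarrow> 0 < rGamma x" for x :: real
  by (simp add: rGamma_inverse_Gamma Gamma_real_pos)

lemma rGamma_real_nonneg: "0 \<le> x \<Longrightarrow> 0 \<le> rGamma x" for x :: real
  using rGamma_real_pos[of x] by (cases "x = 0") auto

lemma rGamma_real_neg:
  fixes x :: real
  assumes "-1 < x" "x < 0"
  shows "rGamma x < 0"
proof -
  have "x * rGamma (x + 1) < 0" using assms rGamma_real_pos[of "x + 1"] by (intro mult_neg_pos) auto
  then show ?thesis by (simp only: rGamma_plus1)
qed

text \<open>This and the next lemma take out the common factor
  \<open>rGamma (A + real j) * rGamma (B + real j)\<close>, so that the quotient of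
  \<open>rGamma_symm\<close> at \<open>(i, j + 1)\<close> and at \<open>(i + 1, j)\<close> is free
  of Gamma values.\<close>

lemma rGamma_symm_pochhammer:
  assumes "i \<le> j"
  shows "rGamma_symm A B i j = rGamma (A + real j) * rGamma (B + real j) *
           (pochhammer (A + real i) (j - i) + pochhammer (B + real i) (j - i))"
  using assms pochhammer_rGamma[of "A + real i" "j - i"] pochhammer_rGamma[of "B + real i" "j - i"]
  by (simp add: rGamma_symm_def of_nat_diff algebra_simps)

lemma rGamma_symm_pochhammer_step:
  assumes "Suc i \<le> j" "0 < A + real j" "0 < B + real j"
  shows "rGamma_symm A B i (Suc j) = rGamma (A + real j) * rGamma (B + real j) *
           (pochhammer (A + real (Suc i)) (j - Suc i) * ((A + real i) / (B + real j)) +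
            pochhammer (B + real (Suc i)) (j - Suc i) * ((B + real i) / (A + real j)))"
proof -
  have down: "rGamma (X + real i) = (X + real i) * (pochhammer (X + real (Suc i)) (j - Suc i) * rGamma (X + real j))" for X
    using rGamma_plus1[of "X + real i"] pochhammer_rGamma[of "X + real (Suc i)" "j - Suc i"] assms(1)
    by (simp add: of_nat_diff algebra_simps)
  have up: "rGamma (X + real (Suc j)) = rGamma (X + real j) / (X + real j)" if "0 < X + real j" for X
    using rGamma_plus1[of "X + real j"] that by (simp add: field_simps)
  show ?thesis
    unfolding rGamma_symm_def down up[OF assms(2)] up[OF assms(3)]
    using assms(2,3) by (simp add: divide_simps) (simp add: algebra_simps)
qed

text \<open>One step away from the middle multiplies each side by a quotient as in
  \<open>symmetric_ratio_mono\<close>. The two pairs have the same sum and \<open>(C, D)\<close> is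
  at least as spread out, so its quotient is at least as large.\<close>

lemma rGamma_symm_le_step:
  assumes "Suc i \<le> j" "-1 < D" "0 \<le> B" "D \<le> B" "B \<le> A" "A + B = C + D"
    and le: "rGamma_symm A B (Suc i) j \<le> rGamma_symm C D (Suc i) j"
  shows "rGamma_symm A B i (Suc j) \<le> rGamma_symm C D i (Suc j)"
proof -
  \<comment> \<open>\<open>c\<close> is the common midpoint of both pairs at index
    \<open>Suc i\<close>; \<open>t\<close> and \<open>T\<close> are their half-differences.\<close>
  define c where "c = (A + B) / 2 + real (Suc i)"
  define t where "t = (A - B) / 2"
  define T where "T = (C - D) / 2"
  define n where "n = j - Suc i"
  define F where "F = c + real n"
  let ?p = "pochhammer (c + t) n" and ?q = "pochhammer (c - t) n"
  let ?P = "pochhammer (c + T) n" and ?Q = "pochhammer (c - T) n"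
  let ?N = "rGamma (F + t) * rGamma (F - t)" and ?M = "rGamma (F + T) * rGamma (F - T)"
  let ?r = "(?p * ((c - 1 + t) / (F - t)) + ?q * ((c - 1 - t) / (F + t))) / (?p + ?q)"
  let ?R = "(?P * ((c - 1 + T) / (F - T)) + ?Q * ((c - 1 - T) / (F + T))) / (?P + ?Q)"
  have eqs: "A + real (Suc i) = c + t" "B + real (Suc i) = c - t" "C + real (Suc i) = c + T" "D + real (Suc i) = c - T"
       "A + real i = c - 1 + t" "B + real i = c - 1 - t" "C + real i = c - 1 + T" "D + real i = c - 1 - T"
       "A + real j = F + t" "B + real j = F - t" "C + real j = F + T" "D + real j = F - T"
    using assms(1,6) unfolding c_def t_def T_def F_def n_def by (auto simp: of_nat_diff field_simps)
  have t: "0 \<le> t" "t \<le> T" "1 \<le> c" "T < c" "c \<le> F" "t \<le> c - 1"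
    using assms(2-6) eqs(4,6) unfolding c_def F_def t_def T_def by (auto simp: field_simps)
  have pos: "0 < ?p" "0 < ?q" "0 < ?P" "0 < ?Q" using t by (auto intro!: pochhammer_pos)
  have N: "0 < ?N" "0 < ?M" using t by (auto intro!: mult_pos_pos rGamma_real_pos)
  have S: "rGamma_symm A B (Suc i) j = ?N * (?p + ?q)" "rGamma_symm C D (Suc i) j = ?M * (?P + ?Q)"
    using rGamma_symm_pochhammer[OF assms(1), of A B] rGamma_symm_pochhammer[OF assms(1), of C D]
    unfolding eqs n_def by auto
  have pochmono: "?q \<le> ?p"
    unfolding pochhammer_prod using t by (intro prod_mono) auto
  have rR: "?r \<le> ?R"
    using t pos pochmono pochhammer_quotient_mono[of t T c n]
    by (intro symmetric_ratio_mono) (auto)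
  \<comment> \<open>Here \<open>c - 1 - t = B + real i\<close> is nonnegative; its analogue
    \<open>D + real i\<close> in \<open>?R\<close> may be negative.\<close>
  have "0 \<le> ?r" using t pos by (intro divide_nonneg_nonneg add_nonneg_nonneg mult_nonneg_nonneg) auto
  have "rGamma_symm A B i (Suc j) = rGamma_symm A B (Suc i) j * ?r"
    using rGamma_symm_pochhammer_step[OF assms(1), of A B] t pos unfolding eqs S n_def[symmetric] by simp
  also have "\<dots> \<le> rGamma_symm C D (Suc i) j * ?R"
  proof (rule mult_mono[OF le rR _ \<open>0 \<le> ?r\<close>])
    show "0 \<le> rGamma_symm C D (Suc i) j"
      unfolding S using pos by (intro mult_nonneg_nonneg[OF less_imp_le[OF N(2)]]) auto
  qed
  also have "\<dots> = rGamma_symm C D i (Suc j)"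
    using rGamma_symm_pochhammer_step[OF assms(1), of C D] t pos unfolding eqs S n_def[symmetric] by simp
  finally show ?thesis .
qed

text \<open>Lifting every \<open>rGamma\<close> value to index \<open>m\<close> by the recurrence
  leaves generalized binomial coefficients over \<open>B + real m - 1\<close> and
  \<open>A + real m - 1\<close>, to which Vandermonde's identity applies.\<close>

lemma rGamma_convolution:
  fixes A B :: real
  shows "(\<Sum>k\<le>m. real (m choose k) * (rGamma (A + real k) * rGamma (B + real (m - k)))) =
         pochhammer (A + B + real m - 1) m * (rGamma (A + real m) * rGamma (B + real m))"
proof -
  have "real (m choose k) * (rGamma (A + real k) * rGamma (B + real (m - k)))
      = fact m * (rGamma (A + real m) * rGamma (B + real m)) *
        (((B + real m - 1) gchoose k) * ((A + real m - 1) gchoose (m - k)))" if "k \<le> m" for k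
  proof -
    have "rGamma (A + real k) = pochhammer (A + real k) (m - k) * rGamma (A + real m)"
      using pochhammer_rGamma[of "A + real k" "m - k"] that by (simp add: of_nat_diff)
    moreover have "rGamma (B + real (m - k)) = pochhammer (B + real (m - k)) k * rGamma (B + real m)"
      using pochhammer_rGamma[of "B + real (m - k)" k] that by (simp add: of_nat_diff)
    moreover have "pochhammer (A + real k) (m - k) = fact (m - k) * ((A + real m - 1) gchoose (m - k))"
      using that by (simp add: gbinomial_pochhammer' of_nat_diff)
    moreover have "pochhammer (B + real (m - k)) k = fact k * ((B + real m - 1) gchoose k)"
      using that by (simp add: gbinomial_pochhammer' of_nat_diff algebra_simps)
    moreover have "real (m choose k) = fact m / (fact k * fact (m - k))"
      using that by (simp add: binomial_fact)
    ultimately show ?thesis by (simp add: field_simps)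
  qed
  then have "(\<Sum>k\<le>m. real (m choose k) * (rGamma (A + real k) * rGamma (B + real (m - k)))) =
     fact m * (rGamma (A + real m) * rGamma (B + real m)) *
       (\<Sum>k\<le>m. ((B + real m - 1) gchoose k) * ((A + real m - 1) gchoose (m - k)))"
    unfolding sum_distrib_left by (intro sum.cong) auto
  also have "(\<Sum>k\<le>m. ((B + real m - 1) gchoose k) * ((A + real m - 1) gchoose (m - k))) =
      (A + B + 2 * real m - 2) gchoose m"
    using gbinomial_Vandermonde[of "B + real m - 1" "A + real m - 1" m]
    by (simp add: atMost_atLeast0 algebra_simps)
  also have "\<dots> = pochhammer (A + B + real m - 1) m / fact m"
    by (simp add: gbinomial_pochhammer' algebra_simps)
  finally show ?thesis by simp
qed

section \<open>Strict log-convexity of Gamma and its form for \<open>rGamma\<close>\<close>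

lemma ln_Gamma_diff_strict_mono:
  fixes x y s :: real
  assumes "0 < x" "x < y" "0 < s"
  shows "ln_Gamma (x + s) - ln_Gamma x < ln_Gamma (y + s) - ln_Gamma y"
proof (rule DERIV_pos_imp_increasing[OF assms(2)])
  fix z assume "x \<le> z" "z \<le> y"
  then have "((\<lambda>z. ln_Gamma (z + s) - ln_Gamma z) has_real_derivative (Digamma (z + s) - Digamma z)) (at z)"
    using assms by (auto intro!: derivative_eq_intros)
  moreover have "0 < Digamma (z + s) - Digamma z"
    using assms \<open>x \<le> z\<close> by (simp add: Digamma_real_strict_mono)
  ultimately show "\<exists>d. ((\<lambda>z. ln_Gamma (z + s) - ln_Gamma z) has_real_derivative d) (at z) \<and> 0 < d" by blast
qed

lemma Gamma_mult_less:
  fixes x s t :: real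
  assumes "0 < x" "0 < s" "0 < t"
  shows "Gamma (x + s) * Gamma (x + t) < Gamma x * Gamma (x + s + t)"
proof -
  have "ln_Gamma (x + s) + ln_Gamma (x + t) < ln_Gamma x + ln_Gamma (x + s + t)"
    using ln_Gamma_diff_strict_mono[of x "x + t" s] assms by (simp add: algebra_simps)
  then have "exp (ln_Gamma (x + s) + ln_Gamma (x + t)) < exp (ln_Gamma x + ln_Gamma (x + s + t))" by simp
  then show ?thesis using assms by (simp add: exp_add Gamma_real_pos_exp)
qed

text \<open>Log-convexity settles \<open>x > 0\<close>. For \<open>-1 < x < 0\<close> the left side
  is negative; at \<open>0\<close> and \<open>-1\<close> it is zero, and the right side is then
  positive unless \<open>x = -1\<close> and \<open>x + s\<close> or \<open>x + t\<close> is
  \<open>0\<close>.\<close>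

lemma rGamma_mult_less:
  fixes x s t :: real
  assumes "-1 \<le> x" "0 < s" "0 < t" "0 \<le> x + s" "0 \<le> x + t"
  shows "rGamma x * rGamma (x + s + t) \<le> rGamma (x + s) * rGamma (x + t)"
    and "\<not> (x = -1 \<and> (s = 1 \<or> t = 1)) \<Longrightarrow> rGamma x * rGamma (x + s + t) < rGamma (x + s) * rGamma (x + t)"
proof -
  show *: "rGamma x * rGamma (x + s + t) < rGamma (x + s) * rGamma (x + t)"
    if "\<not> (x = -1 \<and> (s = 1 \<or> t = 1))"
  proof -
    consider "0 < x" | "x = 0 \<or> x = -1" | "-1 < x" "x < 0" using assms(1) by linarith
    then show ?thesis
    proof cases
      case 1
      then show ?thesis using Gamma_mult_less[of x s t] assms
        by (simp add: rGamma_inverse_Gamma Gamma_real_pos flip: inverse_mult_distrib)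
    next
      case 2
      then have "rGamma x = 0" using rGamma_eq_zero_iff[of x] by auto
      moreover have "0 < rGamma (x + s) * rGamma (x + t)"
        using 2 that assms by (intro mult_pos_pos rGamma_real_pos) auto
      ultimately show ?thesis by simp
    next
      case 3
      then have "rGamma x < 0" by (rule rGamma_real_neg)
      moreover have "0 < rGamma (x + s + t)" using assms by (intro rGamma_real_pos) auto
      moreover have "0 \<le> rGamma (x + s) * rGamma (x + t)"
        using assms by (intro mult_nonneg_nonneg rGamma_real_nonneg) auto
      ultimately show ?thesis by (smt (verit) mult_neg_pos)
    qed
  qed
  show "rGamma x * rGamma (x + s + t) \<le> rGamma (x + s) * rGamma (x + t)"
  proof (cases "x = -1 \<and> (s = 1 \<or> t = 1)")
    case True
    then have "rGamma x = 0" by (auto simp: rGamma_eq_zero_iff)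
    moreover have "0 \<le> rGamma (x + s) * rGamma (x + t)"
      using assms by (intro mult_nonneg_nonneg rGamma_real_nonneg) auto
    ultimately show ?thesis by simp
  qed (use * in auto)
qed

text \<open>If \<open>M\<close> takes negative values, the last negative one below the middle separates
  the indices where \<open>M\<close> is nonpositive from those where it is nonnegative.\<close>

lemma sum_symmetric_weights_ge:
  fixes w M :: "nat \<Rightarrow> real"
  assumes wsym: "\<And>k. k \<le> m \<Longrightarrow> w (m - k) = w k" and Msym: "\<And>k. k \<le> m \<Longrightarrow> M (m - k) = M k"
    and w: "\<And>k l. k \<le> l \<Longrightarrow> 2 * l \<le> m \<Longrightarrow> w k \<le> w l"
    and M: "\<And>k. 2 * Suc k \<le> m \<Longrightarrow> M (Suc k) \<le> 0 \<Longrightarrow> M k \<le> 0"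
    and sum: "0 \<le> (\<Sum>k\<le>m. M k)"
  shows "w 0 * (\<Sum>k\<le>m. M k) \<le> (\<Sum>k\<le>m. w k * M k)"
proof -
  \<comment> \<open>Since \<open>w\<close> and \<open>M\<close> are invariant under \<open>k\<close>
    to \<open>m - k\<close>, comparing terms on the lower half suffices.\<close>
  have lift: "(\<Sum>k\<le>m. v * M k) \<le> (\<Sum>k\<le>m. w k * M k)"
    if *: "\<And>k. 2 * k \<le> m \<Longrightarrow> v * M k \<le> w k * M k" for v
  proof (rule sum_mono)
    fix k assume k: "k \<in> {..m}"
    show "v * M k \<le> w k * M k"
    proof (cases "2 * k \<le> m")
      case False
      then have "v * M (m - k) \<le> w (m - k) * M (m - k)" using k by (intro *) auto
      then show ?thesis using k wsym Msym by auto
    qed (rule *)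
  qed
  show ?thesis
  proof (cases "\<forall>k. 2 * k \<le> m \<longrightarrow> 0 \<le> M k")
    case True
    then have "(\<Sum>k\<le>m. w 0 * M k) \<le> (\<Sum>k\<le>m. w k * M k)"
      using w by (intro lift mult_right_mono) auto
    then show ?thesis by (simp add: sum_distrib_left)
  next
    case False
    define K where "K = {k. 2 * k \<le> m \<and> M k < 0}"
    have "finite K" by (rule finite_subset[of _ "{..m}"]) (auto simp: K_def)
    moreover obtain k where "2 * k \<le> m" "M k < 0" using False by (meson not_less)
    then have "k \<in> K" by (simp add: K_def)
    ultimately have K: "finite K" "K \<noteq> {}" by auto
    define k0 where "k0 = Max K"
    have k0: "2 * k0 \<le> m" "M k0 < 0" using Max_in[OF K] by (auto simp: K_def k0_def)
    have above: "0 \<le> M k" if "k0 < k" "2 * k \<le> m" for k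
      using that Max_ge[OF K(1), of k] by (force simp: K_def k0_def)
    have below: "M k \<le> 0" if "k \<le> k0" for k
      using that
    proof (induction k rule: inc_induct)
      case (step n)
      then show ?case using k0(1) M[of n] by auto
    qed (use k0 in auto)
    \<comment> \<open>The constant weight \<open>w k0\<close> is compared with \<open>w k\<close>:
      left of \<open>k0\<close> the weights are no larger and \<open>M\<close> is nonpositive, right
      of it they are no smaller and \<open>M\<close> is nonnegative.\<close>
    have "w 0 * (\<Sum>k\<le>m. M k) \<le> w k0 * (\<Sum>k\<le>m. M k)"
      using w[of 0 k0] k0 sum by (intro mult_right_mono) auto
    also have "\<dots> = (\<Sum>k\<le>m. w k0 * M k)" by (simp add: sum_distrib_left)
    also have "\<dots> \<le> (\<Sum>k\<le>m. w k * M k)"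
    proof (rule lift)
      fix k assume k: "2 * k \<le> m"
      show "w k0 * M k \<le> w k * M k"
      proof (cases "k \<le> k0")
        case True
        then show ?thesis using w[OF True k0(1)] below by (intro mult_right_mono_neg) auto
      next
        case False
        then show ?thesis using w[of k0 k] k above by (intro mult_right_mono) auto
      qed
    qed
    finally show ?thesis .
  qed
qed

subsection \<open>Coefficients of the Turan-type difference\<close>

text \<open>For \<open>f = poch_quot a b\<close> this is the coefficient of \<open>x ^ n\<close> in
  \<open>hyp_rGamma\<close>. The sequence stays abstract because the estimates rest only on its
  positivity and log-concavity.\<close>

definition rGamma_coeff :: "(nat \<Rightarrow> real) \<Rightarrow> real \<Rightarrow> nat \<Rightarrow> real" where
  "rGamma_coeff f \<nu> n = f n / fact n * rGamma (\<nu> + real n)"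

definition turan_coeff :: "(nat \<Rightarrow> real) \<Rightarrow> real \<Rightarrow> real \<Rightarrow> real \<Rightarrow> nat \<Rightarrow> real" where
  "turan_coeff f \<alpha> \<beta> \<mu> m =
     (\<Sum>k\<le>m. rGamma_coeff f (\<alpha> + \<mu>) k * rGamma_coeff f (\<beta> + \<mu>) (m - k)) -
     (\<Sum>k\<le>m. rGamma_coeff f (\<alpha> + \<beta> + \<mu>) k * rGamma_coeff f \<mu> (m - k))"

text \<open>Adding the reversed sum produces the factor \<open>2\<close>; \<open>fact m\<close>
  turns the two factorials into a binomial coefficient.\<close>

lemma sum_rGamma_coeff_symm:
  "2 * fact m * (\<Sum>k\<le>m. rGamma_coeff f A k * rGamma_coeff f B (m - k)) =
   (\<Sum>k\<le>m. f k * f (m - k) * (real (m choose k) * rGamma_symm A B k (m - k)))"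
proof -
  let ?g = "\<lambda>k l. f k * f l * (fact m / (fact k * fact l)) * (rGamma (A + real k) * rGamma (B + real l))"
  have "fact m * (\<Sum>k\<le>m. rGamma_coeff f A k * rGamma_coeff f B (m - k)) = (\<Sum>k\<le>m. ?g k (m - k))"
    unfolding sum_distrib_left by (intro sum.cong) (auto simp: rGamma_coeff_def field_simps)
  moreover have "(\<Sum>k\<le>m. ?g k (m - k)) = (\<Sum>k\<le>m. ?g (m - k) k)"
    by (rule sum.reindex_bij_witness[of _ "\<lambda>k. m - k" "\<lambda>k. m - k"]) auto
  ultimately have "2 * fact m * (\<Sum>k\<le>m. rGamma_coeff f A k * rGamma_coeff f B (m - k))
      = (\<Sum>k\<le>m. ?g k (m - k)) + (\<Sum>k\<le>m. ?g (m - k) k)" by simp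
  also have "\<dots> = (\<Sum>k\<le>m. f k * f (m - k) * (real (m choose k) * rGamma_symm A B k (m - k)))"
    unfolding sum.distrib[symmetric]
    by (intro sum.cong) (auto simp: rGamma_symm_def binomial_fact field_simps)
  finally show ?thesis .
qed

lemma sum_binomial_rGamma_symm:
  "(\<Sum>k\<le>m. real (m choose k) * rGamma_symm A B k (m - k)) =
   2 * pochhammer (A + B + real m - 1) m * (rGamma (A + real m) * rGamma (B + real m))"
proof -
  have "(\<Sum>k\<le>m. real (m choose k) * (rGamma (A + real (m - k)) * rGamma (B + real k)))
      = (\<Sum>k\<le>m. real (m choose k) * (rGamma (A + real k) * rGamma (B + real (m - k))))"
    by (rule sum.reindex_bij_witness[of _ "\<lambda>k. m - k" "\<lambda>k. m - k"]) (auto simp: binomial_symmetric[symmetric])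
  then show ?thesis
    using rGamma_convolution[of m A B] by (simp add: rGamma_symm_def distrib_left sum.distrib)
qed

lemma rGamma_symm_commute: "rGamma_symm A B i j = rGamma_symm B A i j"
  "rGamma_symm A B i j = rGamma_symm A B j i"
  by (simp_all add: rGamma_symm_def add_ac mult_ac)

text \<open>A step towards the middle replaces the indices \<open>n\<close> and \<open>m - n\<close>
  by \<open>n + 1\<close> and \<open>m - n - 1\<close>, which is one use of log-concavity.\<close>

lemma log_concave_mult_mono:
  fixes f :: "nat \<Rightarrow> real"
  assumes "\<And>k l. k \<le> l \<Longrightarrow> f k * f (Suc l) \<le> f (Suc k) * f l" "k \<le> l" "2 * l \<le> m"
  shows "f k * f (m - k) \<le> f l * f (m - l)"
  using assms(2,3)
proof (induction l rule: dec_induct)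
  case (step n)
  then have "f n * f (Suc (m - Suc n)) \<le> f (Suc n) * f (m - Suc n)" by (intro assms(1)) auto
  then show ?case using step by (simp add: Suc_diff_Suc)
qed simp

text \<open>For \<open>m = 0\<close> the product is empty; otherwise each factor is at least
  \<open>s\<close>.\<close>

lemma pochhammer_shift_nonneg: "0 \<le> s \<Longrightarrow> 0 \<le> pochhammer (s + real m - 1) m"
  unfolding pochhammer_prod by (rule prod_nonneg) auto

text \<open>Replacing every weight \<open>f k * f (m - k)\<close> by the outermost one,
  \<open>f 0 * f m\<close>, does not increase the sum, and the unweighted sum has a closed form. An
  explicit bound, unlike bare positivity, keeps strictness available after a limit in
  \<open>\<mu>\<close>.\<close>

lemma turan_coeff_ge:
  fixes \<alpha> \<beta> \<mu> :: real
  assumes fpos: "\<And>k. 0 < f k" and lc: "\<And>k l. k \<le> l \<Longrightarrow> f k * f (Suc l) \<le> f (Suc k) * f l"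
    and "-1 \<le> \<mu>" "0 < \<alpha>" "0 < \<beta>" "0 \<le> \<mu> + \<alpha>" "0 \<le> \<mu> + \<beta>"
  shows "f 0 * f m * (pochhammer (\<alpha> + \<beta> + 2 * \<mu> + real m - 1) m *
           (rGamma (\<alpha> + \<mu> + real m) * rGamma (\<beta> + \<mu> + real m)
            - rGamma (\<alpha> + \<beta> + \<mu> + real m) * rGamma (\<mu> + real m)))
         \<le> fact m * turan_coeff f \<alpha> \<beta> \<mu> m"
    (is "?L \<mu> \<le> ?R \<mu>")
proof -
  have gen: "?L \<mu> \<le> ?R \<mu>" if \<mu>: "-1 < \<mu>" "0 \<le> \<mu> + \<alpha>" "0 \<le> \<mu> + \<beta>" for \<mu>
  proof -
    define A where "A = \<alpha> + \<mu>"
    define B where "B = \<beta> + \<mu>"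
    define C where "C = \<alpha> + \<beta> + \<mu>"
    define w where "w k = f k * f (m - k)" for k
    define M where "M k = real (m choose k) * (rGamma_symm A B k (m - k) - rGamma_symm C \<mu> k (m - k))" for k
    have sumM: "(\<Sum>k\<le>m. M k) = 2 * (pochhammer (\<alpha> + \<beta> + 2 * \<mu> + real m - 1) m *
         (rGamma (A + real m) * rGamma (B + real m) - rGamma (C + real m) * rGamma (\<mu> + real m)))"
      unfolding M_def right_diff_distrib sum_subtractf sum_binomial_rGamma_symm
      by (simp add: A_def B_def C_def algebra_simps)
    have sumwM: "(\<Sum>k\<le>m. w k * M k) = 2 * ?R \<mu>"
    proof -
      have "2 * ?R \<mu> = 2 * fact m * (\<Sum>k\<le>m. rGamma_coeff f A k * rGamma_coeff f B (m - k))
          - 2 * fact m * (\<Sum>k\<le>m. rGamma_coeff f C k * rGamma_coeff f \<mu> (m - k))"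
        by (simp add: turan_coeff_def A_def B_def C_def right_diff_distrib)
      also have "\<dots> = (\<Sum>k\<le>m. w k * M k)"
        unfolding sum_rGamma_coeff_symm by (simp add: w_def M_def sum_subtractf algebra_simps)
      finally show ?thesis ..
    qed
    have "w 0 * (\<Sum>k\<le>m. M k) \<le> (\<Sum>k\<le>m. w k * M k)"
    proof (rule sum_symmetric_weights_ge)
      fix k assume "k \<le> m"
      then show "w (m - k) = w k" "M (m - k) = M k"
        by (auto simp: w_def M_def binomial_symmetric[symmetric] rGamma_symm_commute(2)[of _ _ "m - k"])
    next
      fix k l assume "k \<le> l" "2 * l \<le> m"
      then show "w k \<le> w l" unfolding w_def using lc by (intro log_concave_mult_mono)
    next
      fix k assume k: "2 * Suc k \<le> m" "M (Suc k) \<le> 0"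
      have le: "rGamma_symm A B (Suc k) (m - Suc k) \<le> rGamma_symm C \<mu> (Suc k) (m - Suc k)"
        using k by (auto simp: M_def mult_le_0_iff)
      have "rGamma_symm A B k (Suc (m - Suc k)) \<le> rGamma_symm C \<mu> k (Suc (m - Suc k))"
      \<comment> \<open>\<open>rGamma_symm_le_step\<close> expects the larger parameter first; the
        symmetry in \<open>A\<close> and \<open>B\<close> covers the other order.\<close>
      proof (cases "B \<le> A")
        case True
        then show ?thesis using k le \<mu> assms
          by (intro rGamma_symm_le_step) (auto simp: A_def B_def C_def)
      next
        case False
        then have "rGamma_symm B A k (Suc (m - Suc k)) \<le> rGamma_symm C \<mu> k (Suc (m - Suc k))"
          using k le \<mu> assms
          by (intro rGamma_symm_le_step) (auto simp: A_def B_def C_def rGamma_symm_commute(1)[of "\<beta> + \<mu>"])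
        then show ?thesis by (simp add: rGamma_symm_commute(1)[of A])
      qed
      moreover have "Suc (m - Suc k) = m - k" using k by auto
      ultimately show "M k \<le> 0" by (auto simp: M_def intro!: mult_nonneg_nonpos)
    next
      have "rGamma (\<mu> + real m) * rGamma (\<mu> + real m + \<alpha> + \<beta>) \<le> rGamma (\<mu> + real m + \<alpha>) * rGamma (\<mu> + real m + \<beta>)"
        using \<mu> assms by (intro rGamma_mult_less(1)) auto
      then have "0 \<le> rGamma (A + real m) * rGamma (B + real m) - rGamma (C + real m) * rGamma (\<mu> + real m)"
        by (simp add: A_def B_def C_def add_ac mult_ac)
      then show "0 \<le> (\<Sum>k\<le>m. M k)" unfolding sumM
        using \<mu> by (intro mult_nonneg_nonneg pochhammer_shift_nonneg) auto
    qed
    then show ?thesis unfolding sumM sumwM by (simp add: w_def A_def B_def C_def)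
  qed
  \<comment> \<open>\<open>rGamma_symm_le_step\<close> needs \<open>\<mu> > -1\<close>; the inequality, unlike strict positivity, survives the limit.\<close>
  show ?thesis
  proof (cases "\<mu> = -1")
    case True
    have [continuous_intros]: "isCont rGamma x" for x :: real
      using has_field_derivative_rGamma by (rule DERIV_isCont)
    have cL: "isCont ?L (-1)" and cR: "isCont ?R (-1)"
      unfolding turan_coeff_def rGamma_coeff_def pochhammer_prod
      by (intro continuous_intros isCont_o2[of _ _ rGamma])+
    have "((\<lambda>\<mu>. ?L \<mu>) \<longlongrightarrow> ?L (-1)) (at_right (-1))" "((\<lambda>\<mu>. ?R \<mu>) \<longlongrightarrow> ?R (-1)) (at_right (-1))"
      using cL cR unfolding isCont_def by (auto intro: tendsto_within_subset)
    \<comment> \<open>With \<open>\<mu> = -1\<close> the assumptions give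
      \<open>1 \<le> \<alpha>\<close> and \<open>1 \<le> \<beta>\<close>, hence \<open>gen\<close>
      applies on all of \<open>(-1, 0)\<close>.\<close>
    moreover have "eventually (\<lambda>\<mu>. ?L \<mu> \<le> ?R \<mu>) (at_right (-1))"
      unfolding eventually_at_right_field using assms(6,7) True
      by (intro exI[of _ 0]) (auto intro!: gen)
    ultimately show ?thesis unfolding True by (intro tendsto_le) auto
  qed (use assms gen in auto)
qed

text \<open>In the bound of \<open>turan_coeff_ge\<close> the Pochhammer factor vanishes only for
  \<open>n = 1\<close> and \<open>\<alpha> + \<beta> + 2 * \<mu> = 0\<close>, the
  \<open>rGamma\<close> difference only for \<open>n = 0\<close>, \<open>\<mu> = -1\<close> and
  \<open>\<alpha> = 1\<close> or \<open>\<beta> = 1\<close>. In these two cases the coefficient is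
  computed directly.\<close>

lemma turan_coeff_pos:
  fixes \<alpha> \<beta> \<mu> :: real
  assumes fpos: "\<And>k. 0 < f k" and lc: "\<And>k l. k \<le> l \<Longrightarrow> f k * f (Suc l) \<le> f (Suc k) * f l"
    and "-1 \<le> \<mu>" "0 < \<alpha>" "0 < \<beta>" "0 \<le> \<mu> + \<alpha>" "0 \<le> \<mu> + \<beta>"
  shows "if n = 0 \<and> \<mu> = -1 \<and> (\<alpha> = 1 \<or> \<beta> = 1) \<or> n = 1 \<and> \<mu> + \<alpha> = 0 \<and> \<mu> + \<beta> = 0
               then turan_coeff f \<alpha> \<beta> \<mu> n = 0 else 0 < turan_coeff f \<alpha> \<beta> \<mu> n"
proof (cases "n = 0 \<and> \<mu> = -1 \<and> (\<alpha> = 1 \<or> \<beta> = 1) \<or> n = 1 \<and> \<mu> + \<alpha> = 0 \<and> \<mu> + \<beta> = 0")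
  case True
  then have "turan_coeff f \<alpha> \<beta> \<mu> n = 0"
  proof
    \<comment> \<open>Both products in the first sum contain \<open>rGamma 0 = 0\<close>; by the
      recurrence the two products in the second sum cancel.\<close>
    assume "n = 1 \<and> \<mu> + \<alpha> = 0 \<and> \<mu> + \<beta> = 0"
    then have "n = 1" "\<beta> = -\<mu>" "\<alpha> = -\<mu>" by auto
    moreover have "rGamma \<mu> = \<mu> * rGamma (\<mu> + 1)" "rGamma (- \<mu>) = - (\<mu> * rGamma (1 - \<mu>))"
      using rGamma_plus1[of \<mu>] rGamma_plus1[of "-\<mu>"] by simp_all
    ultimately show ?thesis by (simp add: turan_coeff_def rGamma_coeff_def)
  qed (auto simp: turan_coeff_def rGamma_coeff_def rGamma_eq_zero_iff)
  then show ?thesis using True by simp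
next
  case False
  have "rGamma (\<mu> + real n) * rGamma (\<mu> + real n + \<alpha> + \<beta>) < rGamma (\<mu> + real n + \<alpha>) * rGamma (\<mu> + real n + \<beta>)"
    using assms False by (intro rGamma_mult_less(2)) auto
  then have "0 < rGamma (\<alpha> + \<mu> + real n) * rGamma (\<beta> + \<mu> + real n)
            - rGamma (\<alpha> + \<beta> + \<mu> + real n) * rGamma (\<mu> + real n)"
    by (simp add: add_ac mult_ac)
  moreover have "0 < pochhammer (\<alpha> + \<beta> + 2 * \<mu> + real n - 1) n"
  proof -
    consider "n = 0" | "n = 1" | "2 \<le> n" by linarith
    then show ?thesis
    proof cases
      case 2
      then show ?thesis using False assms by auto
    next
      case 3
      then have "2 \<le> real n" by simp
      then show ?thesis using assms by (intro pochhammer_pos) linarith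
    qed simp
  qed
  ultimately have "0 < f 0 * f n * (pochhammer (\<alpha> + \<beta> + 2 * \<mu> + real n - 1) n *
           (rGamma (\<alpha> + \<mu> + real n) * rGamma (\<beta> + \<mu> + real n)
            - rGamma (\<alpha> + \<beta> + \<mu> + real n) * rGamma (\<mu> + real n)))"
    using fpos by (intro mult_pos_pos)
  also have "\<dots> \<le> fact n * turan_coeff f \<alpha> \<beta> \<mu> n"
    using assms by (intro turan_coeff_ge) auto
  finally have "0 < turan_coeff f \<alpha> \<beta> \<mu> n" by (simp add: zero_less_mult_iff)
  then show ?thesis using False by simp
qed

subsection \<open>Power series with nonnegative coefficients\<close>

lemma weighted_am_gm:
  fixes x y l :: real
  assumes "0 \<le> x" "0 \<le> y" "0 \<le> l" "l \<le> 1"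
  shows "x powr l * y powr (1 - l) \<le> l * x + (1 - l) * y"
\<comment> \<open>\<open>0 powr s\<close> is \<open>0\<close> even for \<open>s = 0\<close>, so the
  left side vanishes if \<open>x\<close> or \<open>y\<close> does.\<close>
proof (cases "x = 0 \<or> y = 0")
  case False
  then show ?thesis using assms by (intro Youngs_inequality_0) auto
qed (use assms in auto)

text \<open>The tangent of \<open>ln\<close> at the mean \<open>m\<close> lies strictly above
  \<open>ln\<close> at both points, as neither equals \<open>m\<close>; its linear terms cancel in
  the average.\<close>

lemma weighted_am_gm_strict:
  fixes x y l :: real
  assumes "0 < x" "0 < y" "x \<noteq> y" "0 < l" "l < 1"
  shows "x powr l * y powr (1 - l) < l * x + (1 - l) * y"
proof -
  define m where "m = l * x + (1 - l) * y"
  have m: "0 < m" unfolding m_def using assms by (intro add_pos_pos mult_pos_pos) auto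
  have ln_less: "ln z - ln m < z / m - 1" if "0 < z" "z \<noteq> m" for z
    using ln_le_minus_one[of "z / m"] ln_eq_minus_one[of "z / m"] that m by (force simp: ln_div)
  have "x - m = (1 - l) * (x - y)" "y - m = - l * (x - y)"
    unfolding m_def by (simp_all add: algebra_simps)
  then have "x \<noteq> m" "y \<noteq> m" using assms by auto
  then have "l * (ln x - ln m) + (1 - l) * (ln y - ln m) < l * (x / m - 1) + (1 - l) * (y / m - 1)"
    using assms ln_less by (intro add_strict_mono mult_strict_left_mono) auto
  also have "\<dots> = (l * x + (1 - l) * y) / m - 1"
    by (simp add: algebra_simps add_divide_distrib diff_divide_distrib)
  also have "\<dots> = 0" using m by (simp flip: m_def)
  finally have "l * ln x + (1 - l) * ln y < ln m" by (simp add: algebra_simps)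
  then have "exp (l * ln x + (1 - l) * ln y) < m" using m by (metis exp_less_mono exp_ln)
  then show ?thesis using assms by (simp add: powr_def exp_add m_def)
qed

text \<open>After division by the totals, AM-GM bounds each term by a convex combination of the
  terms of two series with sum \<open>1\<close>.\<close>

lemma Hoelder_suminf:
  fixes v w :: "nat \<Rightarrow> real"
  assumes v: "\<And>n. 0 \<le> v n" "summable v" "0 < suminf v"
    and w: "\<And>n. 0 \<le> w n" "summable w" "0 < suminf w"
    and l: "0 \<le> l" "l \<le> 1"
  shows "summable (\<lambda>n. v n powr l * w n powr (1 - l))"
    and "(\<Sum>n. v n powr l * w n powr (1 - l)) \<le> suminf v powr l * suminf w powr (1 - l)"
proof -
  let ?V = "suminf v" and ?W = "suminf w"
  define K where "K = ?V powr l * ?W powr (1 - l)"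
  have K: "0 < K" using v w by (simp add: K_def)
  let ?s = "\<lambda>n. K * (l * (v n / ?V) + (1 - l) * (w n / ?W))"
  have le: "v n powr l * w n powr (1 - l) \<le> ?s n" for n
  proof -
    have "v n powr l * w n powr (1 - l) = K * ((v n / ?V) powr l * (w n / ?W) powr (1 - l))"
      unfolding K_def using v w by (simp add: powr_divide)
    also have "\<dots> \<le> ?s n"
      using K v w l by (intro mult_left_mono weighted_am_gm) auto
    finally show ?thesis .
  qed
  have s: "?s sums (K * (l * (?V / ?V) + (1 - l) * (?W / ?W)))"
    using v w by (intro sums_mult sums_add sums_divide summable_sums)
  show sm: "summable (\<lambda>n. v n powr l * w n powr (1 - l))"
    by (rule summable_comparison_test'[OF sums_summable[OF s], of 0]) (use le in auto)
  have "(\<Sum>n. v n powr l * w n powr (1 - l)) \<le> suminf ?s"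
    using le by (intro suminf_le sm sums_summable[OF s]) auto
  also have "\<dots> = K" using s v w by (simp add: sums_iff)
  finally show "(\<Sum>n. v n powr l * w n powr (1 - l)) \<le> K" .
qed

section \<open>Monotonicity, derivatives and convexity for nonnegative coefficients\<close>

lemma power_series_nonneg_mono:
  fixes c :: "nat \<Rightarrow> real"
  assumes F: "\<And>x. (\<lambda>n. c n * x ^ n) sums F x" and c: "\<And>n. 0 \<le> c n" and "0 \<le> x" "x \<le> y"
  shows "F x \<le> F y"
  using F[of x] F[of y] assms(2-) by (intro sums_le[OF _ F F] mult_left_mono power_mono) auto

lemma power_series_pos:
  fixes c :: "nat \<Rightarrow> real"
  assumes F: "\<And>x. (\<lambda>n. c n * x ^ n) sums F x" and c: "\<And>n. 0 \<le> c n" "0 < c m" and "0 < x"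
  shows "0 < F x"
  using F[of x] c \<open>0 < x\<close> suminf_pos2[of "\<lambda>n. c n * x ^ n" m] by (auto simp: sums_iff)

lemma power_series_deriv:
  fixes c :: "nat \<Rightarrow> real"
  assumes F: "\<And>x. (\<lambda>n. c n * x ^ n) sums F x"
  shows "(F has_real_derivative deriv F x) (at x)" "(\<lambda>n. diffs c n * x ^ n) sums deriv F x"
proof -
  have Feq: "F = (\<lambda>x. \<Sum>n. c n * x ^ n)" using F by (auto simp: sums_iff)
  have sm: "summable (\<lambda>n. c n * y ^ n)" for y using F by (auto simp: sums_iff)
  have d: "(F has_real_derivative (\<Sum>n. diffs c n * x ^ n)) (at x)"
    unfolding Feq by (rule termdiffs_strong_converges_everywhere[OF sm])
  then have e: "deriv F x = (\<Sum>n. diffs c n * x ^ n)" by (rule DERIV_imp_deriv)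
  show "(F has_real_derivative deriv F x) (at x)" using d e by simp
  show "(\<lambda>n. diffs c n * x ^ n) sums deriv F x"
    unfolding e by (rule summable_sums[OF termdiff_converges_all[OF sm]])
qed

lemma power_series_absolutely_monotonic:
  fixes c :: "nat \<Rightarrow> real"
  assumes F: "\<And>x. (\<lambda>n. c n * x ^ n) sums F x" and c: "\<And>n. 0 \<le> c n"
  shows "absolutely_monotonic_on {0<..} F"
proof -
  have ex: "\<exists>d. (\<forall>k. 0 \<le> d k) \<and> (\<forall>x. (\<lambda>k. d k * x ^ k) sums (deriv ^^ n) F x)" for n
  proof (induction n)
    case 0
    then show ?case using F c by auto
  next
    case (Suc n)
    then obtain d where d: "\<And>k. 0 \<le> d k" "\<And>x. (\<lambda>k. d k * x ^ k) sums (deriv ^^ n) F x" by blast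
    have "0 \<le> diffs d k" for k using d(1) by (simp add: diffs_def)
    moreover have "(\<lambda>k. diffs d k * x ^ k) sums (deriv ^^ Suc n) F x" for x
      using power_series_deriv(2)[OF d(2)] by simp
    ultimately show ?case by blast
  qed
  show ?thesis
    unfolding absolutely_monotonic_on_def
  proof (intro allI ballI conjI)
    fix n and x :: real assume x: "x \<in> {0<..}"
    obtain d where d: "\<And>k. 0 \<le> d k" "\<And>x. (\<lambda>k. d k * x ^ k) sums (deriv ^^ n) F x" using ex by blast
    show "(deriv ^^ n) F differentiable at x"
      using power_series_deriv(1)[OF d(2)] real_differentiable_def by blast
    show "0 \<le> (deriv ^^ n) F x"
      using x d(1) by (intro sums_le[OF _ sums_zero d(2)]) auto
  qed
qed

text \<open>Hoelder's inequality for the terms at \<open>x\<close> and \<open>y\<close>: the mixed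
  term is exactly the term at \<open>x powr l * y powr (1 - l)\<close>.\<close>

lemma power_series_multiplicatively_convex:
  fixes c :: "nat \<Rightarrow> real"
  assumes F: "\<And>x. (\<lambda>n. c n * x ^ n) sums F x" and c: "\<And>n. 0 \<le> c n" "0 < c m"
  shows "multiplicatively_convex F"
  unfolding multiplicatively_convex_def
proof (intro allI impI ballI)
  fix x y l :: real assume xy: "x > 0" "y > 0" and l: "l \<in> {0..1}"
  have eq: "(c n * x ^ n) powr l * (c n * y ^ n) powr (1 - l) = c n * (x powr l * y powr (1 - l)) ^ n" for n
  proof (cases "c n = 0")
    case False
    have "c n powr l * c n powr (1 - l) = c n" using False c(1)[of n] by (simp flip: powr_add)
    moreover have "(z ^ n) powr s = (z powr s) ^ n" if "0 < z" for z s :: real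
      using that by (simp add: powr_powr mult.commute flip: powr_realpow)
    ultimately show ?thesis
      using xy c(1)[of n] by (simp add: powr_mult power_mult_distrib)
  qed simp
  have "(\<Sum>n. (c n * x ^ n) powr l * (c n * y ^ n) powr (1 - l))
      \<le> (\<Sum>n. c n * x ^ n) powr l * (\<Sum>n. c n * y ^ n) powr (1 - l)"
    using F[of x] F[of y] power_series_pos[OF F c, of x] power_series_pos[OF F c, of y] xy c l
    by (intro Hoelder_suminf) (auto simp: sums_iff)
  then show "F (x powr l * y powr (1 - l)) \<le> F x powr l * F y powr (1 - l)"
    unfolding eq using F by (simp add: sums_iff)
qed

text \<open>By AM-GM the reciprocal of an arithmetic mean is at most the geometric mean of the
  reciprocals; then \<open>F\<close> is monotone and multiplicatively convex.\<close>

lemma power_series_inverse_log_convex: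
  fixes c :: "nat \<Rightarrow> real"
  assumes F: "\<And>x. (\<lambda>n. c n * x ^ n) sums F x" and c: "\<And>n. 0 \<le> c n" "0 < c m"
  shows "log_convex_on {0<..} (\<lambda>y. F (1 / y))"
proof -
  have pos: "0 < F (1 / y)" if "0 < y" for y using power_series_pos[OF F c] that by simp
  have "convex_on {0<..} (\<lambda>y. ln (F (1 / y)))"
  proof (rule convex_onI)
    fix t x y :: real assume t: "0 < t" "t < 1" and "x \<in> {0<..}" "y \<in> {0<..}"
    then have xy: "0 < x" "0 < y" by auto
    let ?z = "(1 - t) * x + t * y"
    have z: "0 < ?z" using t xy by (intro add_pos_pos mult_pos_pos) auto
    have "1 / ?z \<le> 1 / (x powr (1 - t) * y powr t)"
      using weighted_am_gm[of y x t] xy t z by (intro divide_left_mono) (auto simp: mult_ac add_ac)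
    also have "\<dots> = (1 / y) powr t * (1 / x) powr (1 - t)" using xy by (simp add: powr_divide)
    finally have "F (1 / ?z) \<le> F ((1 / y) powr t * (1 / x) powr (1 - t))"
      using z by (intro power_series_nonneg_mono[OF F c(1)]) auto
    also have "\<dots> \<le> F (1 / y) powr t * F (1 / x) powr (1 - t)"
      using power_series_multiplicatively_convex[OF F c] xy t by (simp add: multiplicatively_convex_def)
    finally have "ln (F (1 / ?z)) \<le> ln (F (1 / y) powr t * F (1 / x) powr (1 - t))"
      using pos z by (intro ln_mono) auto
    also have "\<dots> = (1 - t) * ln (F (1 / x)) + t * ln (F (1 / y))"
      using pos[OF xy(1)] pos[OF xy(2)] by (simp add: ln_mult ln_powr)
    finally show "ln (F (1 / ((1 - t) *\<^sub>R x + t *\<^sub>R y))) \<le> (1 - t) * ln (F (1 / x)) + t * ln (F (1 / y))"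
      by simp
  qed auto
  then show ?thesis using pos by (auto simp: log_convex_on_def)
qed

text \<open>Up to the sign, the \<open>n\<close>-th derivative is
  \<open>(1 / y) ^ n * G (1 / y)\<close> with a series \<open>G\<close> with nonnegative
  coefficients \<open>d k\<close>; the next derivative replaces them by
  \<open>(n + k) * d k\<close>.\<close>

lemma power_series_inverse_completely_monotonic:
  fixes c :: "nat \<Rightarrow> real"
  assumes F: "\<And>x. (\<lambda>n. c n * x ^ n) sums F x" and c: "\<And>n. 0 \<le> c n"
  shows "completely_monotonic_on {0<..} (\<lambda>y. F (1 / y))"
proof -
  let ?H = "\<lambda>n. (deriv ^^ n) (\<lambda>y. F (1 / y))"
  have deriv_step: "(?H n has_real_derivative (-1) ^ Suc n * (1 / y) ^ Suc n * (real n * G (1 / y) + (1 / y) * deriv G (1 / y))) (at y)"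
    if "\<And>x. (\<lambda>k. d k * x ^ k) sums G x" "\<And>y. 0 < y \<Longrightarrow> ?H n y = (-1) ^ n * (1 / y) ^ n * G (1 / y)" "0 < y"
    for d :: "nat \<Rightarrow> real" and G n y
  proof -
    have G: "(G has_real_derivative deriv G (1 / y)) (at (1 / y))"
      using power_series_deriv(1)[OF that(1)] .
    have inv: "((\<lambda>y. 1 / y) has_real_derivative - ((1 / y) * (1 / y))) (at y)"
      using that(3) by (auto intro!: derivative_eq_intros)
    \<comment> \<open>The truncated exponent at \<open>n = 0\<close> is harmless: the factor
      \<open>real n\<close> vanishes.\<close>
    have "real n * (- ((1 / y) * (1 / y)) * (1 / y) ^ (n - Suc 0)) = - (real n * (1 / y) ^ Suc n)"
      by (cases n) auto
    with DERIV_power[OF inv, of n]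
    have pow: "((\<lambda>y. (1 / y) ^ n) has_real_derivative - (real n * (1 / y) ^ Suc n)) (at y)"
      by simp
    have "((\<lambda>y. (-1) ^ n * ((1 / y) ^ n * G (1 / y))) has_real_derivative
        (-1) ^ n * (- (real n * (1 / y) ^ Suc n) * G (1 / y)
          + deriv G (1 / y) * - ((1 / y) * (1 / y)) * (1 / y) ^ n)) (at y)"
      by (intro DERIV_cmult DERIV_mult pow DERIV_chain2[where g = "\<lambda>y. 1 / y", OF G inv])
    then have "((\<lambda>y. (-1) ^ n * (1 / y) ^ n * G (1 / y)) has_real_derivative
        (-1) ^ Suc n * (1 / y) ^ Suc n * (real n * G (1 / y) + (1 / y) * deriv G (1 / y))) (at y)"
      by (simp add: algebra_simps)
    then show ?thesis
      by (rule has_field_derivative_transform_within_open[of _ _ _ "{0<..}"]) (use that in auto)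
  qed
  have ex: "\<exists>d G. (\<forall>k. 0 \<le> d k) \<and> (\<forall>x. (\<lambda>k. d k * x ^ k) sums G x) \<and>
      (\<forall>y>0. ?H n y = (-1) ^ n * (1 / y) ^ n * G (1 / y))" for n
  proof (induction n)
    case 0
    show ?case using F c by (intro exI[of _ c] exI[of _ F]) auto
  next
    case (Suc n)
    then obtain d G where d: "\<And>k. 0 \<le> d k" "\<And>x. (\<lambda>k. d k * x ^ k) sums G x"
      and H: "\<And>y. 0 < y \<Longrightarrow> ?H n y = (-1) ^ n * (1 / y) ^ n * G (1 / y)" by blast
    let ?d = "\<lambda>k. real n * d k + real k * d k"
    let ?G = "\<lambda>x. real n * G x + x * deriv G x"
    have "(\<lambda>k. ?d k * x ^ k) sums ?G x" for x
    proof -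
      have "(\<lambda>k. x * (diffs d k * x ^ k)) sums (x * deriv G x)"
        by (intro sums_mult power_series_deriv(2)[OF d(2)])
      then have "(\<lambda>k. real (Suc k) * d (Suc k) * x ^ Suc k) sums (x * deriv G x)"
        by (simp add: diffs_def mult_ac)
      then have "(\<lambda>k. real k * d k * x ^ k) sums (x * deriv G x)"
        by (subst (asm) sums_Suc_iff) simp
      from sums_add[OF sums_mult[OF d(2), of "real n" x] this] show ?thesis
        by (simp add: algebra_simps)
    qed
    moreover have "?H (Suc n) y = (-1) ^ Suc n * (1 / y) ^ Suc n * ?G (1 / y)" if "0 < y" for y
      using DERIV_imp_deriv[OF deriv_step[OF d(2) H that]] by simp
    moreover have "0 \<le> ?d k" for k using d(1) by simp
    ultimately show ?case by (intro exI[of _ ?d] exI[of _ ?G]) blast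
  qed
  show ?thesis
    unfolding completely_monotonic_on_def
  proof (intro allI ballI conjI)
    fix n and y :: real assume "y \<in> {0<..}"
    then have y: "0 < y" by simp
    obtain d G where d: "\<And>k. 0 \<le> d k" "\<And>x. (\<lambda>k. d k * x ^ k) sums G x"
      and H: "\<And>y. 0 < y \<Longrightarrow> ?H n y = (-1) ^ n * (1 / y) ^ n * G (1 / y)" using ex by blast
    show "?H n differentiable at y" using deriv_step[OF d(2) H y] real_differentiable_def by blast
    have "0 \<le> G (1 / y)" using y d(1) by (intro sums_le[OF _ sums_zero d(2)]) auto
    then show "0 \<le> (-1) ^ n * ?H n y" using y by (simp add: H flip: mult.assoc power_mult_distrib)
  qed
qed

lemma nn_integral_power_exp_scaled:
  assumes "0 < x"
  shows "(\<integral>\<^sup>+t. ennreal (t ^ k / fact k * exp (- t / x)) * indicator {0..} t \<partial>lborel) = ennreal (x ^ Suc k)"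
proof -
  \<comment> \<open>Substituting \<open>t = x * s\<close> leaves the integral of
    \<open>s ^ k * exp (- s)\<close>, which is \<open>k!\<close>.\<close>
  have "(\<integral>\<^sup>+t. ennreal (t ^ k / fact k * exp (- t / x)) * indicator {0..} t \<partial>lborel)
      = ennreal \<bar>x\<bar> * (\<integral>\<^sup>+s. ennreal ((0 + x * s) ^ k / fact k * exp (- (0 + x * s) / x)) * indicator {0..} (0 + x * s) \<partial>lborel)"
    using assms by (intro nn_integral_real_affine) auto
  also have "\<dots> = ennreal x * (\<integral>\<^sup>+s. ennreal (x ^ k / fact k) * (ennreal (s ^ k * exp (- s)) * indicator {0..} s) \<partial>lborel)"
  proof -
    have "ennreal ((0 + x * s) ^ k / fact k * exp (- (0 + x * s) / x)) * indicator {0..} (0 + x * s)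
        = ennreal (x ^ k / fact k) * (ennreal (s ^ k * exp (- s)) * indicator {0..} s)" for s
      using assms
      by (cases "0 \<le> s") (simp_all add: power_mult_distrib zero_le_mult_iff mult_ac flip: ennreal_mult)
    then show ?thesis using assms by simp
  qed
  also have "\<dots> = ennreal x * (ennreal (x ^ k / fact k) * ennreal (fact k))"
    by (subst nn_integral_cmult) (auto simp: nn_intergal_power_times_exp_Ici)
  also have "\<dots> = ennreal (x ^ Suc k)"
    using assms by (simp add: ennreal_mult[symmetric])
  finally show ?thesis .
qed

text \<open>The measure is the image of a density on \<open>nat \<times> real\<close>: the constant term becomes
  an atom at \<open>0\<close>, and \<open>c (Suc k) * x ^ Suc k\<close> is the transform of \<open>c (Suc k) * t ^ k / k!\<close>.\<close>

lemma power_series_Laplace_measure: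
  fixes c :: "nat \<Rightarrow> real"
  assumes F: "\<And>x. (\<lambda>n. c n * x ^ n) sums F x" and c: "\<And>n. 0 \<le> c n"
  shows "\<exists>\<tau> :: real measure. sets \<tau> = sets borel \<and> emeasure \<tau> {..<0} = 0 \<and>
          (\<forall>x>0. set_integrable \<tau> {0..} (\<lambda>t. exp (- t / x)) \<and>
                 F x = (LINT t:{0..}|\<tau>. exp (- t / x)))"
proof -
  define N where "N = (count_space UNIV :: nat measure) \<Otimes>\<^sub>M (lborel :: real measure)"
  \<comment> \<open>Fibre \<open>0\<close> has mass \<open>c 0\<close>, spread over the unit
    interval and collapsed by \<open>h\<close> to the point \<open>0\<close>; on fibre
    \<open>Suc k\<close> the map \<open>h\<close> returns \<open>t\<close>.\<close>
  define d :: "nat \<Rightarrow> real \<Rightarrow> real" where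
    "d n t = (case n of 0 \<Rightarrow> c 0 * indicator {0..1} t | Suc k \<Rightarrow> c (Suc k) * (t ^ k / fact k) * indicator {0..} t)" for n t
  define h :: "nat \<times> real \<Rightarrow> real" where "h z = (case fst z of 0 \<Rightarrow> 0 | Suc k \<Rightarrow> snd z)" for z
  have N: "sets N = sets (count_space UNIV \<Otimes>\<^sub>M borel)" unfolding N_def by (intro sets_pair_measure_cong) auto
  have [measurable]: "(\<lambda>z. d (fst z) (snd z)) \<in> borel_measurable N"
    unfolding N_def d_def by measurable
  have [measurable]: "h \<in> N \<rightarrow>\<^sub>M borel"
    unfolding N_def h_def by measurable
  define \<tau> where "\<tau> = distr (density N (\<lambda>z. ennreal (d (fst z) (snd z)))) borel h"
  \<comment> \<open>By Tonelli, an integral against \<open>\<tau>\<close> is a series of integrals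
    over the fibres.\<close>
  have int: "(\<integral>\<^sup>+t. g t \<partial>\<tau>) = (\<Sum>n. \<integral>\<^sup>+t. ennreal (d n t) * g (h (n, t)) \<partial>lborel)"
    if [measurable]: "g \<in> borel_measurable borel" for g :: "real \<Rightarrow> ennreal"
  proof -
    have "(\<integral>\<^sup>+t. g t \<partial>\<tau>) = (\<integral>\<^sup>+z. ennreal (d (fst z) (snd z)) * g (h z) \<partial>N)"
      unfolding \<tau>_def by (subst nn_integral_distr) (auto simp: nn_integral_density)
    also have "\<dots> = (\<integral>\<^sup>+n. \<integral>\<^sup>+t. ennreal (d n t) * g (h (n, t)) \<partial>lborel \<partial>count_space UNIV)"
    proof -
      have "(\<lambda>z. ennreal (d (fst z) (snd z)) * g (h z)) \<in> borel_measurable N" by measurable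
      from lborel.nn_integral_fst[OF this[unfolded N_def]] show ?thesis by (simp add: N_def)
    qed
    finally show ?thesis by (simp add: nn_integral_count_space_nat)
  qed
  have sets: "sets \<tau> = sets borel" by (simp add: \<tau>_def)
  have "emeasure \<tau> {..<0} = (\<integral>\<^sup>+t. indicator {..<0} t \<partial>\<tau>)" using sets by simp
  also have "\<dots> = (\<Sum>n. \<integral>\<^sup>+t. ennreal (d n t) * indicator {..<0} (h (n, t)) \<partial>lborel)"
    by (rule int) auto
  also have "\<dots> = (\<Sum>n. \<integral>\<^sup>+t. 0 \<partial>(lborel :: real measure))"
    by (intro arg_cong[of _ _ suminf] ext nn_integral_cong)
      (auto simp: d_def h_def split: nat.splits split_indicator)
  finally have null: "emeasure \<tau> {..<0} = 0" by simp
  have "has_bochner_integral \<tau> (\<lambda>t. indicator {0..} t *\<^sub>R exp (- t / x)) (F x)" if x: "0 < x" for x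
  proof (rule has_bochner_integral_nn_integral)
    show "(\<lambda>t. indicator {0..} t *\<^sub>R exp (- t / x)) \<in> borel_measurable \<tau>"
      unfolding measurable_cong_sets[OF sets refl] by measurable
    show "0 \<le> F x" using x c by (intro sums_le[OF _ sums_zero F]) auto
    have "(\<integral>\<^sup>+t. ennreal (indicator {0..} t *\<^sub>R exp (- t / x)) \<partial>\<tau>) =
        (\<Sum>n. \<integral>\<^sup>+t. ennreal (d n t) * ennreal (indicator {0..} (h (n, t)) *\<^sub>R exp (- h (n, t) / x)) \<partial>lborel)"
      by (rule int) measurable
    also have "\<dots> = (\<Sum>n. ennreal (c n * x ^ n))"
    proof (intro arg_cong[of _ _ suminf] ext)
      fix n
      show "(\<integral>\<^sup>+t. ennreal (d n t) * ennreal (indicator {0..} (h (n, t)) *\<^sub>R exp (- h (n, t) / x)) \<partial>lborel) = ennreal (c n * x ^ n)"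
      proof (cases n)
        case 0
        have "(\<integral>\<^sup>+t. ennreal (d n t) * ennreal (indicator {0..} (h (n, t)) *\<^sub>R exp (- h (n, t) / x)) \<partial>lborel)
            = (\<integral>\<^sup>+t. ennreal (c 0) * indicator {0..1::real} t \<partial>lborel)"
          unfolding 0 by (intro nn_integral_cong) (auto simp: d_def h_def split: split_indicator)
        then show ?thesis using 0 by (simp add: nn_integral_cmult)
      next
        case (Suc k)
        have "(\<integral>\<^sup>+t. ennreal (d n t) * ennreal (indicator {0..} (h (n, t)) *\<^sub>R exp (- h (n, t) / x)) \<partial>lborel)
            = (\<integral>\<^sup>+t. ennreal (c (Suc k)) * (ennreal (t ^ k / fact k * exp (- t / x)) * indicator {0..} t) \<partial>lborel)"
          unfolding Suc using c
          by (intro nn_integral_cong) (auto simp: d_def h_def ennreal_mult[symmetric] mult.assoc split: split_indicator)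
        also have "\<dots> = ennreal (c (Suc k)) * ennreal (x ^ Suc k)"
          by (subst nn_integral_cmult) (auto simp only: nn_integral_power_exp_scaled[OF x], measurable)
        also have "\<dots> = ennreal (c n * x ^ n)" using Suc c x by (simp add: ennreal_mult)
        finally show ?thesis .
      qed
    qed
    also have "\<dots> = ennreal (F x)"
      using F[of x] x c by (subst suminf_ennreal2) (auto simp: sums_iff)
    finally show "(\<integral>\<^sup>+t. ennreal (indicator {0..} t *\<^sub>R exp (- t / x)) \<partial>\<tau>) = ennreal (F x)" .
  qed (auto simp: indicator_def)
  then show ?thesis
    using sets null unfolding set_integrable_def set_lebesgue_integral_def
    by (intro exI[of _ \<tau>]) (auto simp: has_bochner_integral_iff)
qed

subsection \<open>The functions \<open>hyp_rGamma\<close> and \<open>phi\<close>\<close>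

lemma prod_list_add_pos: "\<forall>u\<in>set c. 0 < u \<Longrightarrow> 0 < (\<Prod>u\<leftarrow>c. u + real n)"
  by (induction c) (auto intro!: mult_pos_pos add_pos_nonneg)

lemma poch_quot_0 [simp]: "poch_quot a b 0 = 1"
proof -
  have "(\<Prod>u\<leftarrow>c. pochhammer u 0) = 1" for c :: "real list" by (induction c) auto
  then show ?thesis by (simp add: poch_quot_def)
qed

lemma poch_quot_pos:
  assumes "\<forall>u\<in>set a. 0 < u" "\<forall>u\<in>set b. 0 < u"
  shows "0 < poch_quot a b n"
proof -
  have "0 < (\<Prod>u\<leftarrow>c. pochhammer u n)" if "\<forall>u\<in>set c. 0 < u" for c :: "real list"
    using that by (induction c) (auto intro!: mult_pos_pos pochhammer_pos)
  then show ?thesis using assms by (simp add: poch_quot_def)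
qed

text \<open>Consecutive quotients of \<open>poch_quot\<close> are the values at integers of a
  quotient of polynomials that decreases by \<open>elem_sym_quotient_mono\<close>.\<close>

lemma poch_quot_log_concave:
  assumes "r = length b - length a" "length a \<le> length b"
    and ab: "\<forall>u\<in>set a. 0 < u" "\<forall>u\<in>set b. 0 < u"
    and "\<forall>k<length a. elem_sym (r + Suc k) b / elem_sym (Suc k) a \<le> elem_sym (r + k) b / elem_sym k a"
    and "k \<le> l"
  shows "poch_quot a b k * poch_quot a b (Suc l) \<le> poch_quot a b (Suc k) * poch_quot a b l"
proof -
  have "(\<Prod>u\<leftarrow>a. u + real l) / (\<Prod>u\<leftarrow>b. u + real l) \<le> (\<Prod>u\<leftarrow>a. u + real k) / (\<Prod>u\<leftarrow>b. u + real k)"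
    using elem_sym_quotient_mono[OF assms(1-5), of "real k" "real l"] assms(6)
      prod_list_add_pos[OF ab(2), of k] prod_list_add_pos[OF ab(2), of l]
    by (simp add: field_simps)
  then have "poch_quot a b k * poch_quot a b l * ((\<Prod>u\<leftarrow>a. u + real l) / (\<Prod>u\<leftarrow>b. u + real l))
      \<le> poch_quot a b k * poch_quot a b l * ((\<Prod>u\<leftarrow>a. u + real k) / (\<Prod>u\<leftarrow>b. u + real k))"
    using poch_quot_pos[OF ab, of k] poch_quot_pos[OF ab, of l] by (intro mult_left_mono) auto
  then show ?thesis by (simp add: poch_quot_Suc mult_ac)
qed

lemma poch_quot_le_power:
  assumes "length a \<le> length b" "\<forall>u\<in>set a. 0 < u" "\<forall>u\<in>set b. 0 < u"
  shows "\<exists>C>0. \<forall>n. poch_quot a b n \<le> C ^ n"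
proof -
  obtain C where C: "C > 0" "\<And>n. (\<Prod>u\<leftarrow>a. u + real n) \<le> C * (\<Prod>u\<leftarrow>b. u + real n)"
    using poch_quot_ratio_bounded[OF assms] by blast
  have "poch_quot a b n \<le> C ^ n" for n
  proof (induction n)
    case 0
    show ?case by simp
  next
    case (Suc n)
    have "(\<Prod>u\<leftarrow>a. u + real n) / (\<Prod>u\<leftarrow>b. u + real n) \<le> C"
      using C(2)[of n] prod_list_add_pos[OF assms(3), of n] by (simp add: field_simps)
    moreover have "0 \<le> (\<Prod>u\<leftarrow>a. u + real n) / (\<Prod>u\<leftarrow>b. u + real n)"
      using prod_list_add_pos[OF assms(2), of n] prod_list_add_pos[OF assms(3), of n] by simp
    ultimately have "poch_quot a b n * ((\<Prod>u\<leftarrow>a. u + real n) / (\<Prod>u\<leftarrow>b. u + real n)) \<le> C ^ n * C"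
      using Suc C(1) by (intro mult_mono) auto
    then show ?case by (simp add: poch_quot_Suc mult.commute)
  qed
  with C(1) show ?thesis by blast
qed

text \<open>Continuity gives a bound up to \<open>2\<close>; beyond,
  \<open>rGamma x = rGamma (x - 1) / (x - 1)\<close> with \<open>x - 1 \<ge> 1\<close> carries the
  same bound one unit further at a time.\<close>

lemma rGamma_real_bounded: "\<exists>K. \<forall>x::real. - M \<le> x \<longrightarrow> \<bar>rGamma x\<bar> \<le> K"
proof -
  have "bounded (rGamma ` {- \<bar>M\<bar>..2})"
    by (intro compact_imp_bounded compact_continuous_image continuous_intros compact_Icc)
  then obtain K where "\<forall>x\<in>{- \<bar>M\<bar>..2}. \<bar>rGamma x\<bar> \<le> K"
    by (auto simp: bounded_iff)
  then have K: "\<bar>rGamma x\<bar> \<le> K" if "- \<bar>M\<bar> \<le> x" "x \<le> 2" for x using that by auto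
  have "\<bar>rGamma x\<bar> \<le> K" if "- \<bar>M\<bar> \<le> x" "x \<le> 2 + real n" for n x
    using that
  proof (induction n arbitrary: x)
    case (Suc n)
    show ?case
    proof (cases "x \<le> 2 + real n")
      case False
      then have x: "1 \<le> x - 1" by auto
      have "1 * \<bar>rGamma x\<bar> \<le> (x - 1) * \<bar>rGamma x\<bar>" using x by (intro mult_right_mono) auto
      also have "\<dots> = \<bar>(x - 1) * rGamma x\<bar>" using x by (simp add: abs_mult)
      also have "\<dots> = \<bar>rGamma (x - 1)\<bar>" using rGamma_plus1[of "x - 1"] by simp
      also have "\<dots> \<le> K" using Suc x by auto
      finally show ?thesis by simp
    qed (use Suc in auto)
  qed (use K in auto)
  moreover have "x \<le> 2 + real (nat \<lceil>x\<rceil>)" for x :: real by linarith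
  ultimately show ?thesis by (intro exI[of _ K]) (smt (verit))
qed

lemma hyp_rGamma_eq: "hyp_rGamma a b \<nu> x = (\<Sum>n. rGamma_coeff (poch_quot a b) \<nu> n * x ^ n)"
  by (simp add: hyp_rGamma_def rGamma_coeff_def mult_ac)

text \<open>The exponential majorant is uniform in \<open>\<nu>\<close>: it yields absolute
  convergence for fixed \<open>\<nu>\<close> and, by the Weierstrass test, continuity in
  \<open>\<nu>\<close>.\<close>

lemma rGamma_coeff_majorant:
  fixes M x :: real
  assumes "length a \<le> length b" "\<forall>u\<in>set a. 0 < u" "\<forall>u\<in>set b. 0 < u"
  shows "\<exists>g. summable g \<and> (\<forall>n \<nu>. - M \<le> \<nu> \<longrightarrow> norm (rGamma_coeff (poch_quot a b) \<nu> n * x ^ n) \<le> g n)"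
proof -
  obtain K where K: "\<And>x. - M \<le> x \<Longrightarrow> \<bar>rGamma x\<bar> \<le> K" using rGamma_real_bounded by blast
  have "0 \<le> K" using K[of "-M"] by simp
  obtain C where C: "C > 0" "\<And>n. poch_quot a b n \<le> C ^ n" using poch_quot_le_power[OF assms] by blast
  have "norm (rGamma_coeff (poch_quot a b) \<nu> n * x ^ n) \<le> K * (inverse (fact n) * (C * \<bar>x\<bar>) ^ n)" if "- M \<le> \<nu>" for n \<nu>
  proof -
    have "norm (rGamma_coeff (poch_quot a b) \<nu> n * x ^ n)
        = (poch_quot a b n * \<bar>x\<bar> ^ n / fact n) * \<bar>rGamma (\<nu> + real n)\<bar>"
      using poch_quot_pos[OF assms(2,3), of n] by (simp add: rGamma_coeff_def abs_mult power_abs)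
    also have "\<dots> \<le> (C ^ n * \<bar>x\<bar> ^ n / fact n) * K"
      using C K[of "\<nu> + real n"] that poch_quot_pos[OF assms(2,3), of n] \<open>0 \<le> K\<close>
      by (intro mult_mono divide_right_mono mult_right_mono) auto
    finally show ?thesis by (simp add: power_mult_distrib field_simps)
  qed
  moreover have "summable (\<lambda>n. K * (inverse (fact n) * (C * \<bar>x\<bar>) ^ n))"
    by (intro summable_mult summable_exp)
  ultimately show ?thesis by blast
qed

lemma summable_norm_rGamma_coeff:
  assumes "length a \<le> length b" "\<forall>u\<in>set a. 0 < u" "\<forall>u\<in>set b. 0 < u"
  shows "summable (\<lambda>n. norm (rGamma_coeff (poch_quot a b) \<nu> n * x ^ n))"
proof -
  obtain g where "summable g" "\<And>n \<nu>'. - (- \<nu>) \<le> \<nu>' \<Longrightarrow> norm (rGamma_coeff (poch_quot a b) \<nu>' n * x ^ n) \<le> g n"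
    using rGamma_coeff_majorant[OF assms, of "- \<nu>" x] by blast
  then have "\<And>n. norm (norm (rGamma_coeff (poch_quot a b) \<nu> n * x ^ n)) \<le> g n" by simp
  then show ?thesis by (rule summable_comparison_test'[OF \<open>summable g\<close>])
qed

lemma hyp_rGamma_sums:
  assumes "length a \<le> length b" "\<forall>u\<in>set a. 0 < u" "\<forall>u\<in>set b. 0 < u"
  shows "(\<lambda>n. rGamma_coeff (poch_quot a b) \<nu> n * x ^ n) sums hyp_rGamma a b \<nu> x"
  unfolding hyp_rGamma_eq by (rule summable_sums[OF summable_norm_cancel[OF summable_norm_rGamma_coeff[OF assms]]])

lemma continuous_on_hyp_rGamma:
  assumes "length a \<le> length b" "\<forall>u\<in>set a. 0 < u" "\<forall>u\<in>set b. 0 < u"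
  shows "continuous_on {0<..} (\<lambda>\<nu>. hyp_rGamma a b \<nu> x)"
proof -
  obtain g where g: "summable g" "\<And>n \<nu>. - 0 \<le> \<nu> \<Longrightarrow> norm (rGamma_coeff (poch_quot a b) \<nu> n * x ^ n) \<le> g n"
    using rGamma_coeff_majorant[OF assms, of 0 x] by blast
  have "uniform_limit {0<..} (\<lambda>N \<nu>. \<Sum>n<N. rGamma_coeff (poch_quot a b) \<nu> n * x ^ n)
      (\<lambda>\<nu>. \<Sum>n. rGamma_coeff (poch_quot a b) \<nu> n * x ^ n) sequentially"
    using g by (intro Weierstrass_m_test) auto
  then show ?thesis
    unfolding hyp_rGamma_eq
    by (rule uniform_limit_theorem[rotated])
      (auto simp: rGamma_coeff_def intro!: always_eventually continuous_intros continuous_on_compose2[OF continuous_on_rGamma[of UNIV]])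
qed

lemma phi_sums:
  assumes "length a \<le> length b" "\<forall>u\<in>set a. 0 < u" "\<forall>u\<in>set b. 0 < u"
  shows "(\<lambda>n. turan_coeff (poch_quot a b) \<alpha> \<beta> \<mu> n * x ^ n) sums phi a b \<alpha> \<beta> \<mu> x"
proof -
  let ?c = "rGamma_coeff (poch_quot a b)"
  have "(\<lambda>n. (\<Sum>k\<le>n. ?c A k * ?c B (n - k)) * x ^ n) sums (hyp_rGamma a b A x * hyp_rGamma a b B x)" for A B
  proof -
    have "(\<lambda>n. \<Sum>k\<le>n. ?c A k * x ^ k * (?c B (n - k) * x ^ (n - k))) sums
        (hyp_rGamma a b A x * hyp_rGamma a b B x)"
      unfolding hyp_rGamma_eq by (intro Cauchy_product_sums summable_norm_rGamma_coeff assms)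
    moreover have "(\<Sum>k\<le>n. ?c A k * x ^ k * (?c B (n - k) * x ^ (n - k))) = (\<Sum>k\<le>n. ?c A k * ?c B (n - k)) * x ^ n" for n
      unfolding sum_distrib_right
    proof (intro sum.cong refl)
      fix k assume "k \<in> {..n}"
      then have "x ^ n = x ^ k * x ^ (n - k)" by (simp flip: power_add)
      then show "?c A k * x ^ k * (?c B (n - k) * x ^ (n - k)) = ?c A k * ?c B (n - k) * x ^ n" by simp
    qed
    ultimately show ?thesis by simp
  qed
  from sums_diff[OF this[of "\<alpha> + \<mu>" "\<beta> + \<mu>"] this[of "\<alpha> + \<beta> + \<mu>" \<mu>]]
  show ?thesis by (simp add: phi_def turan_coeff_def left_diff_distrib)
qed

lemma hyp_rGamma_0: "hyp_rGamma a b \<nu> 0 = rGamma \<nu>"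
  unfolding hyp_rGamma_eq by (subst powser_zero) (simp add: rGamma_coeff_def)

lemma hyp_rGamma_pos:
  assumes ab: "length a \<le> length b" "\<forall>u\<in>set a. 0 < u" "\<forall>u\<in>set b. 0 < u"
    and "\<nu> = -1 \<or> 0 \<le> \<nu>" "0 < x"
  shows "0 < hyp_rGamma a b \<nu> x"
proof (rule power_series_pos[of "rGamma_coeff (poch_quot a b) \<nu>" "hyp_rGamma a b \<nu>" 2])
  have nn: "0 \<le> rGamma (\<nu> + real n)" for n
  proof (cases "\<nu> = -1 \<and> n = 0")
    case True
    then show ?thesis by (simp add: rGamma_eq_zero_iff)
  qed (use assms in \<open>auto intro!: rGamma_real_nonneg\<close>)
  show "0 \<le> rGamma_coeff (poch_quot a b) \<nu> n" for n
    using nn poch_quot_pos[OF ab(2,3), of n] by (simp add: rGamma_coeff_def)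
  \<comment> \<open>Index \<open>2\<close> is the first that works throughout: at
    \<open>\<nu> = -1\<close> the coefficients \<open>0\<close> and \<open>1\<close> vanish.\<close>
  have "0 < rGamma (\<nu> + real 2)" using assms by (intro rGamma_real_pos) auto
  then show "0 < rGamma_coeff (poch_quot a b) \<nu> 2"
    using poch_quot_pos[OF ab(2,3), of 2] by (simp add: rGamma_coeff_def)
qed (use assms hyp_rGamma_sums[OF ab] in auto)

section \<open>Comparison of hypergeometric functions in a lower parameter\<close>

lemma pochhammer_weighted_am_gm:
  fixes x y l :: real
  assumes "0 < x" "0 < y" "0 \<le> l" "l \<le> 1"
  shows "pochhammer x n powr l * pochhammer y n powr (1 - l) \<le> pochhammer (l * x + (1 - l) * y) n"
proof (induction n)
  case (Suc n)
  have "(x + real n) powr l * (y + real n) powr (1 - l) \<le> l * (x + real n) + (1 - l) * (y + real n)"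
    using assms by (intro weighted_am_gm) auto
  also have "\<dots> = l * x + (1 - l) * y + real n" by (simp add: algebra_simps)
  finally have *: "(x + real n) powr l * (y + real n) powr (1 - l) \<le> l * x + (1 - l) * y + real n" .
  have "pochhammer x (Suc n) powr l * pochhammer y (Suc n) powr (1 - l)
      = (pochhammer x n powr l * pochhammer y n powr (1 - l)) * ((x + real n) powr l * (y + real n) powr (1 - l))"
    using assms by (simp add: pochhammer_Suc powr_mult pochhammer_nonneg mult_ac)
  also have "\<dots> \<le> pochhammer (l * x + (1 - l) * y) n * (l * x + (1 - l) * y + real n)"
  proof -
    have "0 \<le> l * x + (1 - l) * y" using assms by auto
    moreover from this have "0 \<le> pochhammer (l * x + (1 - l) * y) n"
      unfolding pochhammer_prod by (intro prod_nonneg) auto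
    ultimately show ?thesis by (intro mult_mono Suc.IH *) auto
  qed
  finally show ?case by (simp add: pochhammer_Suc)
qed simp

text \<open>Reciprocal Pochhammer symbols are log-convex in the parameter by
  \<open>pochhammer_weighted_am_gm\<close>, and Hoelder's inequality passes this to the sum.\<close>

lemma hypergeom_log_convex_strict:
  fixes s t l x :: real
  assumes ab: "length a \<le> length b" "\<forall>u\<in>set a. 0 < u" "\<forall>u\<in>set b. 0 < u"
    and st: "0 < s" "0 < t" "s \<noteq> t" and l: "0 < l" "l < 1" and x: "0 < x"
  shows "hypergeom a ((l * s + (1 - l) * t) # b) x < hypergeom a (s # b) x powr l * hypergeom a (t # b) x powr (1 - l)"
proof -
  let ?h = "\<lambda>\<nu> n. poch_quot a (\<nu> # b) n * x ^ n / fact n"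
  let ?m = "l * s + (1 - l) * t"
  define k where "k n = poch_quot a b n * x ^ n / fact n" for n
  have k: "0 < k n" for n using poch_quot_pos[OF ab(2,3), of n] x by (simp add: k_def)
  have m: "0 < ?m" using st l by (intro add_pos_pos mult_pos_pos) auto
  have h: "?h \<nu> n = k n / pochhammer \<nu> n" for \<nu> n by (simp add: k_def poch_quot_def)
  have hpos: "0 < ?h \<nu> n" if "0 < \<nu>" for \<nu> n unfolding h using k that by (intro divide_pos_pos pochhammer_pos)
  have sm: "summable (?h \<nu>)" for \<nu> by (rule summable_hypergeom[OF ab])
  have Hpos: "0 < suminf (?h \<nu>)" if "0 < \<nu>" for \<nu> using hpos[OF that] sm by (intro suminf_pos) auto
  let ?g = "\<lambda>n. ?h s n powr l * ?h t n powr (1 - l)"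
  have g: "?g n = k n / (pochhammer s n powr l * pochhammer t n powr (1 - l))" for n
    unfolding h using k[of n] st by (simp add: powr_divide pochhammer_nonneg pochhammer_pos less_imp_le flip: powr_add)
  have le: "?h ?m n \<le> ?g n" for n
    unfolding g unfolding h using k[of n] m st l pochhammer_pos[of s n] pochhammer_pos[of t n] pochhammer_pos[OF m, of n]
    by (intro divide_left_mono pochhammer_weighted_am_gm) auto
  \<comment> \<open>\<open>pochhammer \<nu> 1 = \<nu>\<close>, so this term is strict by AM-GM with
    \<open>s \<noteq> t\<close>.\<close>
  have less: "?h ?m 1 < ?g 1"
    unfolding g unfolding h using k[of 1] m weighted_am_gm_strict[OF st l] st by (intro divide_strict_left_mono) auto
  have smg: "summable ?g"
    using st l hpos Hpos sm by (intro Hoelder_suminf) (auto simp: less_imp_le)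
  have "0 < (\<Sum>n. ?g n - ?h ?m n)"
    using le less by (intro suminf_pos2[of _ 1] summable_diff smg sm) auto
  then have "suminf (?h ?m) < suminf ?g"
    using suminf_diff[OF smg sm[of ?m]] by simp
  also have "suminf ?g \<le> suminf (?h s) powr l * suminf (?h t) powr (1 - l)"
    using st l hpos Hpos sm by (intro Hoelder_suminf) (auto simp: less_imp_le)
  finally show ?thesis by (simp add: hypergeom_def)
qed

text \<open>The two middle parameters are convex combinations of the outer ones with exchanged
  weights, so in the product of the two bounds the exponents add up to \<open>1\<close>.\<close>

lemma hypergeom_mult_less:
  fixes \<mu> \<alpha> \<beta> x :: real
  assumes ab: "length a \<le> length b" "\<forall>u\<in>set a. 0 < u" "\<forall>u\<in>set b. 0 < u"
    and "0 < \<mu>" "0 < \<alpha>" "0 < \<beta>" "0 < x"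
  shows "hypergeom a ((\<alpha> + \<mu>) # b) x * hypergeom a ((\<beta> + \<mu>) # b) x
       < hypergeom a (\<mu> # b) x * hypergeom a ((\<alpha> + \<beta> + \<mu>) # b) x"
proof -
  define l where "l = \<alpha> / (\<alpha> + \<beta>)"
  let ?H = "\<lambda>\<nu>. hypergeom a (\<nu> # b) x"
  let ?D = "?H \<mu>" and ?C = "?H (\<alpha> + \<beta> + \<mu>)"
  have l: "0 < l" "l < 1" and "l * (\<alpha> + \<beta>) = \<alpha>" using assms by (auto simp: l_def)
  then have e: "l * (\<alpha> + \<beta> + \<mu>) + (1 - l) * \<mu> = \<alpha> + \<mu>" "(1 - l) * (\<alpha> + \<beta> + \<mu>) + (1 - (1 - l)) * \<mu> = \<beta> + \<mu>"
    by (simp_all add: algebra_simps)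
  have pos: "0 < ?H \<nu>" if "0 < \<nu>" for \<nu>
    unfolding hypergeom_def using summable_hypergeom[OF ab] poch_quot_pos[of a "\<nu> # b"] that ab assms(7)
    by (intro suminf_pos) auto
  have "?H (\<alpha> + \<mu>) < ?C powr l * ?D powr (1 - l)"
    using hypergeom_log_convex_strict[OF ab, of "\<alpha> + \<beta> + \<mu>" \<mu> l x] assms l e(1) by auto
  moreover have "?H (\<beta> + \<mu>) < ?C powr (1 - l) * ?D powr (1 - (1 - l))"
    using hypergeom_log_convex_strict[OF ab, of "\<alpha> + \<beta> + \<mu>" \<mu> "1 - l" x] assms l e(2) by auto
  ultimately have "?H (\<alpha> + \<mu>) * ?H (\<beta> + \<mu>) < (?C powr l * ?D powr (1 - l)) * (?C powr (1 - l) * ?D powr (1 - (1 - l)))"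
    using pos[of "\<alpha> + \<mu>"] pos[of "\<beta> + \<mu>"] assms by (intro mult_strict_mono) auto
  also have "\<dots> = (?C powr l * ?C powr (1 - l)) * (?D powr l * ?D powr (1 - l))" by (simp add: mult_ac)
  also have "\<dots> = ?D * ?C"
    using pos[of \<mu>] pos[of "\<alpha> + \<beta> + \<mu>"] assms by (simp flip: powr_add)
  finally show ?thesis .
qed

text \<open>Dropping the negative terms bounds the factor at \<open>\<mu>\<close> by
  \<open>1\<close>. The factor at \<open>\<alpha> + \<beta> + \<mu>\<close> is at most that at
  \<open>\<alpha> + \<mu>\<close>, and the one at \<open>\<beta> + \<mu>\<close> exceeds its
  constant term \<open>1\<close>.\<close>

lemma hypergeom_mult_greater:
  fixes \<mu> \<alpha> \<beta> x :: real
  assumes ab: "length a \<le> length b" "\<forall>u\<in>set a. 0 < u" "\<forall>u\<in>set b. 0 < u"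
    and \<mu>: "-1 < \<mu>" "\<mu> < 0" and "0 < \<alpha> + \<mu>" "0 < \<beta> + \<mu>" "0 < x"
  shows "hypergeom a (\<mu> # b) x * hypergeom a ((\<alpha> + \<beta> + \<mu>) # b) x
       < hypergeom a ((\<alpha> + \<mu>) # b) x * hypergeom a ((\<beta> + \<mu>) # b) x"
proof -
  let ?h = "\<lambda>\<nu> n. poch_quot a (\<nu> # b) n * x ^ n / fact n"
  let ?H = "\<lambda>\<nu>. hypergeom a (\<nu> # b) x"
  have h: "?h \<nu> n = poch_quot a b n * x ^ n / fact n / pochhammer \<nu> n" for \<nu> n by (simp add: poch_quot_def)
  have k: "0 < poch_quot a b n * x ^ n / fact n" for n using poch_quot_pos[OF ab(2,3), of n] assms by simp
  have sm: "summable (?h \<nu>)" for \<nu> by (rule summable_hypergeom[OF ab])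
  have hpos: "0 < ?h \<nu> n" if "0 < \<nu>" for \<nu> n unfolding h using k that by (intro divide_pos_pos[OF k] pochhammer_pos)
  have one: "(\<lambda>n. if n = 0 then 1 else 0 :: real) sums 1" using sums_single[of 0 "\<lambda>_. 1 :: real"] by simp
  have "?H \<mu> \<le> 1"
  proof -
    have "?h \<mu> n \<le> (if n = 0 then 1 else 0)" for n
    proof (cases n)
      case (Suc m)
      have "pochhammer \<mu> n < 0"
        unfolding Suc pochhammer_rec using \<mu> by (intro mult_neg_pos pochhammer_pos) auto
      then have "?h \<mu> n < 0" unfolding h by (rule divide_pos_neg[OF k])
      then show ?thesis using Suc by simp
    qed simp
    from sums_le[OF this summable_sums[OF sm] one] show ?thesis by (simp add: hypergeom_def)
  qed
  moreover have "0 < ?H (\<alpha> + \<beta> + \<mu>)"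
    unfolding hypergeom_def using assms by (intro suminf_pos sm hpos) auto
  ultimately have "?H \<mu> * ?H (\<alpha> + \<beta> + \<mu>) \<le> ?H (\<alpha> + \<beta> + \<mu>)" by (simp add: mult_left_le_one_le mult_le_cancel_right1)
  also have "\<dots> \<le> ?H (\<alpha> + \<mu>)"
    unfolding hypergeom_def
  proof (rule suminf_le[OF _ sm sm])
    fix n
    have "pochhammer (\<alpha> + \<mu>) n \<le> pochhammer (\<alpha> + \<beta> + \<mu>) n"
      unfolding pochhammer_prod using assms by (intro prod_mono) auto
    then show "?h (\<alpha> + \<beta> + \<mu>) n \<le> ?h (\<alpha> + \<mu>) n"
      unfolding h using k[of n] assms by (intro divide_left_mono mult_pos_pos pochhammer_pos) auto
  qed
  also have "\<dots> < ?H (\<alpha> + \<mu>) * ?H (\<beta> + \<mu>)"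
  proof -
    have "0 < ?H (\<alpha> + \<mu>)" unfolding hypergeom_def using assms by (intro suminf_pos sm hpos) auto
    moreover have "1 < ?H (\<beta> + \<mu>)"
    proof -
      have "(\<lambda>n. ?h (\<beta> + \<mu>) n - (if n = 0 then 1 else 0)) sums (?H (\<beta> + \<mu>) - 1)"
        unfolding hypergeom_def by (intro sums_diff summable_sums sm one)
      moreover have "0 \<le> ?h (\<beta> + \<mu>) n - (if n = 0 then 1 else 0)" for n
        using less_imp_le[OF hpos[OF assms(7), of n]] by (cases n) auto
      moreover have "0 < ?h (\<beta> + \<mu>) 1 - (if 1 = (0::nat) then 1 else 0)"
        using hpos[OF assms(7), of 1] by simp
      ultimately show ?thesis using suminf_pos2[of "\<lambda>n. ?h (\<beta> + \<mu>) n - (if n = 0 then 1 else 0)" 1] by (simp add: sums_iff)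
    qed
    ultimately show ?thesis by simp
  qed
  finally show ?thesis .
qed

subsection \<open>Bounds for the quotient\<close>

text \<open>\<open>P\<close> is arbitrary because the numerator may be infinite at
  \<open>\<mu> = -1\<close>; times \<open>inverse (\<plusminus>\<infinity>) = 0\<close> it still
  gives \<open>0\<close>.\<close>

lemma Gamma_ext_quotient_pole:
  assumes "\<mu> = 0 \<or> \<mu> = -1" "0 < C"
  shows "P / (Gamma_ext \<mu> * Gamma_ext C) = 0"
proof -
  have "Gamma C \<noteq> 0" using Gamma_real_pos[OF assms(2)] by linarith
  then show ?thesis using assms by (auto simp: Gamma_ext_def divide_ereal_def)
qed

lemma Gamma_ext_quotient_minus_infinity:
  assumes "-1 < \<mu>" "\<mu> < 0" "0 < C" "0 \<le> A" "0 \<le> B" "A = 0 \<or> B = 0"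
  shows "Gamma_ext A * Gamma_ext B / (Gamma_ext \<mu> * Gamma_ext C) = - \<infinity>"
proof -
  have g: "0 < Gamma_ext z" if "0 \<le> z" for z
    using that Gamma_real_pos[of z] by (auto simp: Gamma_ext_def)
  have "Gamma_ext A * Gamma_ext B = \<infinity>"
    using assms(6) g[OF assms(4)] g[OF assms(5)] by (auto simp: Gamma_ext_def)
  moreover have "Gamma \<mu> < 0"
    using rGamma_real_neg[OF assms(1,2)] by (simp add: rGamma_inverse_Gamma)
  then have "Gamma \<mu> * Gamma C < 0"
    using Gamma_real_pos[OF assms(3)] by (rule mult_neg_pos)
  moreover have "Gamma_ext \<mu> * Gamma_ext C = ereal (Gamma \<mu> * Gamma C)"
    using assms by (simp add: Gamma_ext_def)
  moreover have "\<infinity> / ereal y = - \<infinity>" if "y < 0" for y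
    using that by (simp add: divide_ereal_def)
  ultimately show ?thesis by metis
qed

lemma Gamma_ext_quotient_regular:
  assumes "-1 < \<mu>" "\<mu> \<noteq> 0" "0 < C" "0 < A" "0 < B"
  shows "Gamma_ext A * Gamma_ext B / (Gamma_ext \<mu> * Gamma_ext C) = ereal (Gamma A * Gamma B / (Gamma \<mu> * Gamma C))"
proof -
  have "\<mu> \<notin> \<int>\<^sub>\<le>\<^sub>0" using assms by (auto simp: nonpos_Ints_def)
  then have "Gamma \<mu> * Gamma C \<noteq> 0"
    using assms Gamma_real_pos[of C] by (auto simp: Gamma_eq_zero_iff)
  then show ?thesis using assms by (simp add: Gamma_ext_def)
qed

lemma hyp_rGamma_ratio_bounds_0:
  fixes \<alpha> \<beta> \<mu> :: real
  assumes "-1 \<le> \<mu>" "0 < \<alpha>" "0 < \<beta>" "0 \<le> \<mu> + \<alpha>" "0 \<le> \<mu> + \<beta>"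
  defines "ratio \<equiv> ereal (rGamma \<mu> * rGamma (\<alpha> + \<beta> + \<mu>)) / ereal (rGamma (\<alpha> + \<mu>) * rGamma (\<beta> + \<mu>))"
  shows "Gamma_ext (\<alpha> + \<mu>) * Gamma_ext (\<beta> + \<mu>) / (Gamma_ext \<mu> * Gamma_ext (\<alpha> + \<beta> + \<mu>)) = ratio \<and> ratio < 1"
proof -
  have C: "0 < \<alpha> + \<beta> + \<mu>" using assms by linarith
  consider "\<mu> = 0 \<or> \<mu> = -1" | "-1 < \<mu>" "\<mu> \<noteq> 0" "0 < \<alpha> + \<mu>" "0 < \<beta> + \<mu>"
    | "-1 < \<mu>" "\<mu> < 0" "\<alpha> + \<mu> = 0 \<or> \<beta> + \<mu> = 0"
    using assms by linarith
  then show ?thesis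
  proof cases
    case 1
    then have "rGamma \<mu> = 0" by (auto simp: rGamma_eq_zero_iff)
    \<comment> \<open>This includes \<open>0 / 0\<close>, which is
      \<open>0 * \<infinity> = 0\<close>.\<close>
    then have "ratio = 0" by (simp add: ratio_def divide_ereal_def)
    then show ?thesis using Gamma_ext_quotient_pole[OF 1 C] by simp
  next
    case 2
    have pos: "0 < rGamma (\<alpha> + \<mu>) * rGamma (\<beta> + \<mu>)" using 2 by (intro mult_pos_pos rGamma_real_pos)
    have r: "ratio = ereal (rGamma \<mu> * rGamma (\<alpha> + \<beta> + \<mu>) / (rGamma (\<alpha> + \<mu>) * rGamma (\<beta> + \<mu>)))"
      unfolding ratio_def using pos by (subst ereal_divide) auto
    have "rGamma \<mu> * rGamma (\<mu> + \<alpha> + \<beta>) < rGamma (\<mu> + \<alpha>) * rGamma (\<mu> + \<beta>)"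
      using assms 2 by (intro rGamma_mult_less(2)) auto
    then have "ratio < 1" unfolding r using pos by (simp add: add_ac)
    moreover have "Gamma_ext (\<alpha> + \<mu>) * Gamma_ext (\<beta> + \<mu>) / (Gamma_ext \<mu> * Gamma_ext (\<alpha> + \<beta> + \<mu>)) = ratio"
      unfolding r Gamma_ext_quotient_regular[OF 2(1,2) C 2(3,4)] by (simp add: rGamma_inverse_Gamma field_simps)
    ultimately show ?thesis by simp
  next
    case 3
    have "rGamma \<mu> * rGamma (\<alpha> + \<beta> + \<mu>) < 0"
      using rGamma_real_neg[OF 3(1,2)] rGamma_real_pos[OF C] by (rule mult_neg_pos)
    moreover have "rGamma (\<alpha> + \<mu>) * rGamma (\<beta> + \<mu>) = 0" using 3 by auto
    moreover have "ereal y / ereal 0 = - \<infinity>" if "y < 0" for y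
      using that by (simp add: divide_ereal_def)
    ultimately have "ratio = - \<infinity>" unfolding ratio_def by metis
    then show ?thesis using Gamma_ext_quotient_minus_infinity[OF 3(1,2) C _ _ 3(3)] assms by simp
  qed
qed

text \<open>For \<open>x > 0\<close> the denominator is positive, so the quotient is finite and the
  upper bound is positivity of \<open>phi\<close>. The lower bound is immediate where the Gamma side
  is \<open>0\<close> or \<open>-\<infinity>\<close>; elsewhere hypergeometric functions are
  compared.\<close>

lemma hyp_rGamma_ratio_bounds:
  fixes \<alpha> \<beta> \<mu> x :: real
  assumes ab: "length a \<le> length b" "\<forall>u\<in>set a. 0 < u" "\<forall>u\<in>set b. 0 < u"
    and par: "-1 \<le> \<mu>" "0 < \<alpha>" "0 < \<beta>" "0 \<le> \<mu> + \<alpha>" "0 \<le> \<mu> + \<beta>"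
    and x: "0 < x" and phi: "0 < phi a b \<alpha> \<beta> \<mu> x"
  defines "ratio \<equiv> ereal (hyp_rGamma a b \<mu> x * hyp_rGamma a b (\<alpha> + \<beta> + \<mu>) x) /
                      ereal (hyp_rGamma a b (\<alpha> + \<mu>) x * hyp_rGamma a b (\<beta> + \<mu>) x)"
  shows "Gamma_ext (\<alpha> + \<mu>) * Gamma_ext (\<beta> + \<mu>) / (Gamma_ext \<mu> * Gamma_ext (\<alpha> + \<beta> + \<mu>)) < ratio \<and> ratio < 1"
proof -
  let ?F = "\<lambda>\<nu>. hyp_rGamma a b \<nu> x" and ?H = "\<lambda>\<nu>. hypergeom a (\<nu> # b) x"
  have C: "0 < \<alpha> + \<beta> + \<mu>" using par by linarith
  have Fpos: "0 < ?F \<nu>" if "\<nu> = -1 \<or> 0 \<le> \<nu>" for \<nu> using hyp_rGamma_pos[OF ab, of \<nu> x] that x by auto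
  have den: "0 < ?F (\<alpha> + \<mu>) * ?F (\<beta> + \<mu>)" using Fpos par by (intro mult_pos_pos) auto
  have r: "ratio = ereal (?F \<mu> * ?F (\<alpha> + \<beta> + \<mu>) / (?F (\<alpha> + \<mu>) * ?F (\<beta> + \<mu>)))"
    unfolding ratio_def using den by (subst ereal_divide) auto
  have "ratio < 1" unfolding r using den phi by (simp add: phi_def mult_ac)
  moreover have "Gamma_ext (\<alpha> + \<mu>) * Gamma_ext (\<beta> + \<mu>) / (Gamma_ext \<mu> * Gamma_ext (\<alpha> + \<beta> + \<mu>)) < ratio"
  proof -
    consider "\<mu> = 0 \<or> \<mu> = -1" | "-1 < \<mu>" "\<mu> \<noteq> 0" "0 < \<alpha> + \<mu>" "0 < \<beta> + \<mu>"
      | "-1 < \<mu>" "\<mu> < 0" "\<alpha> + \<mu> = 0 \<or> \<beta> + \<mu> = 0"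
      using par by linarith
    then show ?thesis
    proof cases
      case 1
      have "0 < ?F \<mu> * ?F (\<alpha> + \<beta> + \<mu>)" using 1 C by (intro mult_pos_pos Fpos) auto
      then have "0 < ratio" unfolding r using den by simp
      then show ?thesis using Gamma_ext_quotient_pole[OF 1 C] by simp
    next
      case 2
      have nonpos: "\<nu> \<notin> \<int>\<^sub>\<le>\<^sub>0" if "-1 < \<nu>" "\<nu> \<noteq> 0" for \<nu> :: real using that by (auto simp: nonpos_Ints_def)
      have F: "?F \<nu> = ?H \<nu> / Gamma \<nu>" if "-1 < \<nu>" "\<nu> \<noteq> 0" for \<nu>
        using hyp_rGamma_eq_hypergeom[OF ab nonpos[OF that]] by simp
      let ?Q = "Gamma (\<alpha> + \<mu>) * Gamma (\<beta> + \<mu>) / (Gamma \<mu> * Gamma (\<alpha> + \<beta> + \<mu>))"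
      let ?R = "?H \<mu> * ?H (\<alpha> + \<beta> + \<mu>) / (?H (\<alpha> + \<mu>) * ?H (\<beta> + \<mu>))"
      have G: "0 < Gamma (\<alpha> + \<mu>)" "0 < Gamma (\<beta> + \<mu>)" "0 < Gamma (\<alpha> + \<beta> + \<mu>)"
        using 2 C by (simp_all add: Gamma_real_pos)
      have H: "0 < ?H (\<alpha> + \<mu>) * ?H (\<beta> + \<mu>)"
      proof -
        have "?H (\<alpha> + \<mu>) * ?H (\<beta> + \<mu>) = ?F (\<alpha> + \<mu>) * ?F (\<beta> + \<mu>) * (Gamma (\<alpha> + \<mu>) * Gamma (\<beta> + \<mu>))"
          using F[of "\<alpha> + \<mu>"] F[of "\<beta> + \<mu>"] 2 less_imp_neq[OF G(1)] less_imp_neq[OF G(2)] by simp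
        then show ?thesis using mult_pos_pos[OF den mult_pos_pos[OF G(1,2)]] by (simp only:)
      qed
      have FQ: "?F \<mu> * ?F (\<alpha> + \<beta> + \<mu>) / (?F (\<alpha> + \<mu>) * ?F (\<beta> + \<mu>)) = ?Q * ?R"
        using F[of \<mu>] F[of "\<alpha> + \<mu>"] F[of "\<beta> + \<mu>"] F[of "\<alpha> + \<beta> + \<mu>"] 2 C by (simp add: field_simps)
      \<comment> \<open>\<open>?Q\<close> and \<open>?R - 1\<close> have the same sign: positive for
        \<open>\<mu> > 0\<close>, negative for \<open>\<mu> < 0\<close>.\<close>
      have "?Q * 1 < ?Q * ?R"
      proof (cases "0 < \<mu>")
        case True
        then have "1 < ?R" using hypergeom_mult_less[OF ab True par(2,3) x] H by simp
        moreover have "0 < ?Q" using G Gamma_real_pos[OF True] by simp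
        ultimately show ?thesis by (rule mult_strict_left_mono)
      next
        case False
        then have \<mu>: "\<mu> < 0" using 2 by simp
        then have "?R < 1" using hypergeom_mult_greater[OF ab 2(1) \<mu> 2(3,4) x] H by simp
        moreover have "Gamma \<mu> < 0" using rGamma_real_neg[OF 2(1) \<mu>] by (simp add: rGamma_inverse_Gamma)
        then have "?Q < 0" using G by (simp add: divide_pos_neg mult_neg_pos)
        ultimately show ?thesis by (rule mult_strict_left_mono_neg)
      qed
      then show ?thesis unfolding r FQ Gamma_ext_quotient_regular[OF 2(1,2) C 2(3,4)] by simp
    next
      case 3
      then show ?thesis unfolding r using Gamma_ext_quotient_minus_infinity[OF 3(1,2) C _ _ 3(3)] par by simp
    qed
  qed
  ultimately show ?thesis by simp
qed

text \<open>Strictness comes from coefficient \<open>2\<close>, since coefficients \<open>0\<close>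
  and \<open>1\<close> may vanish in the boundary cases.\<close>

lemma phi_strict_mono:
  assumes ab: "length a \<le> length b" "\<forall>u\<in>set a. 0 < u" "\<forall>u\<in>set b. 0 < u"
    and c: "\<And>n. 0 \<le> turan_coeff (poch_quot a b) \<alpha> \<beta> \<mu> n" "0 < turan_coeff (poch_quot a b) \<alpha> \<beta> \<mu> 2"
    and "0 < x"
  shows "phi a b \<alpha> \<beta> \<mu> 0 < phi a b \<alpha> \<beta> \<mu> x"
proof -
  let ?c = "turan_coeff (poch_quot a b) \<alpha> \<beta> \<mu>"
  have "(\<lambda>n. ?c n * x ^ n - ?c n * 0 ^ n) sums (phi a b \<alpha> \<beta> \<mu> x - phi a b \<alpha> \<beta> \<mu> 0)"
    by (intro sums_diff phi_sums ab)
  moreover have "0 \<le> ?c n * x ^ n - ?c n * 0 ^ n" for n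
    using c(1)[of n] assms(6) by (cases n) auto
  moreover have "0 < ?c 2 * x ^ 2 - ?c 2 * 0 ^ 2" using c(2) assms(6) by simp
  ultimately show ?thesis
    using suminf_pos2[of "\<lambda>n. ?c n * x ^ n - ?c n * 0 ^ n" 2] by (auto simp: sums_iff)
qed

theorem theorem3:
  fixes p q r :: nat and a b :: "real list"
  assumes "p \<le> q" and "r = q - p"
    and "length a = p" and "length b = q"
    and "\<forall>u\<in>set a. 0 < u" and "\<forall>u\<in>set b. 0 < u"
    and "\<forall>k<p. elem_sym (r + Suc k) b / elem_sym (Suc k) a
               \<le> elem_sym (r + k) b / elem_sym k a"
  shows
    "(\<forall>x\<ge>0. strictly_log_concave_on {0<..} (\<lambda>\<nu>. hyp_rGamma a b \<nu> x)) \<and>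
     (\<forall>\<mu> \<alpha> \<beta>. \<mu> \<ge> -1 \<longrightarrow> \<alpha> > 0 \<longrightarrow> \<beta> > 0 \<longrightarrow> \<mu> + \<alpha> \<ge> 0 \<longrightarrow> \<mu> + \<beta> \<ge> 0 \<longrightarrow>
       (\<exists>c :: nat \<Rightarrow> real. (\<forall>x. (\<lambda>n. c n * x ^ n) sums phi a b \<alpha> \<beta> \<mu> x) \<and>
          (\<forall>n. if n = 0 \<and> \<mu> = -1 \<and> (\<alpha> = 1 \<or> \<beta> = 1) \<or>
                  n = 1 \<and> \<mu> + \<alpha> = 0 \<and> \<mu> + \<beta> = 0
               then c n = 0 else 0 < c n)) \<and>
       absolutely_monotonic_on {0<..} (phi a b \<alpha> \<beta> \<mu>) \<and>
       multiplicatively_convex (phi a b \<alpha> \<beta> \<mu>) \<and>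
       completely_monotonic_on {0<..} (\<lambda>y. phi a b \<alpha> \<beta> \<mu> (1 / y)) \<and>
       log_convex_on {0<..} (\<lambda>y. phi a b \<alpha> \<beta> \<mu> (1 / y)) \<and>
       (\<exists>\<tau> :: real measure. sets \<tau> = sets borel \<and> emeasure \<tau> {..<0} = 0 \<and>
          (\<forall>x>0. set_integrable \<tau> {0..} (\<lambda>t. exp (- t / x)) \<and>
                 phi a b \<alpha> \<beta> \<mu> x = (LINT t:{0..}|\<tau>. exp (- t / x)))) \<and>
       (\<forall>x\<ge>0.
          let lhs = Gamma_ext (\<alpha> + \<mu>) * Gamma_ext (\<beta> + \<mu>) / (Gamma_ext \<mu> * Gamma_ext (\<alpha> + \<beta> + \<mu>));
              ratio = ereal (hyp_rGamma a b \<mu> x * hyp_rGamma a b (\<alpha> + \<beta> + \<mu>) x) /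
                      ereal (hyp_rGamma a b (\<alpha> + \<mu>) x * hyp_rGamma a b (\<beta> + \<mu>) x)
          in (if x = 0 then lhs = ratio else lhs < ratio) \<and> ratio < 1) \<and>
       (\<forall>x\<ge>0.
          phi a b \<alpha> \<beta> \<mu> x
            \<ge> rGamma (\<mu> + \<alpha>) * rGamma (\<mu> + \<beta>) - rGamma \<mu> * rGamma (\<mu> + \<alpha> + \<beta>) \<and>
          (phi a b \<alpha> \<beta> \<mu> x
             = rGamma (\<mu> + \<alpha>) * rGamma (\<mu> + \<beta>) - rGamma \<mu> * rGamma (\<mu> + \<alpha> + \<beta>)
           \<longleftrightarrow> x = 0)))"
    (is "_ \<and> (\<forall>\<mu> \<alpha> \<beta>. _ \<longrightarrow> _ \<longrightarrow> _ \<longrightarrow> _ \<longrightarrow> _ \<longrightarrow> ?S \<mu> \<alpha> \<beta>)")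
proof -
  have ab: "length a \<le> length b" "\<forall>u\<in>set a. 0 < u" "\<forall>u\<in>set b. 0 < u" using assms by auto
  have lc: "poch_quot a b k * poch_quot a b (Suc l) \<le> poch_quot a b (Suc k) * poch_quot a b l" if "k \<le> l" for k l
    using assms that by (intro poch_quot_log_concave[of r]) auto
  let ?c = "turan_coeff (poch_quot a b)"
  have c: "if n = 0 \<and> \<mu> = -1 \<and> (\<alpha> = 1 \<or> \<beta> = 1) \<or> n = 1 \<and> \<mu> + \<alpha> = 0 \<and> \<mu> + \<beta> = 0
           then ?c \<alpha> \<beta> \<mu> n = 0 else 0 < ?c \<alpha> \<beta> \<mu> n"
    if "\<mu> \<ge> -1" "\<alpha> > 0" "\<beta> > 0" "\<mu> + \<alpha> \<ge> 0" "\<mu> + \<beta> \<ge> 0" for \<mu> \<alpha> \<beta> n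
    using that by (intro turan_coeff_pos poch_quot_pos ab lc)
  have c_nonneg: "0 \<le> ?c \<alpha> \<beta> \<mu> n" and c_pos: "0 < ?c \<alpha> \<beta> \<mu> 2"
    if "\<mu> \<ge> -1" "\<alpha> > 0" "\<beta> > 0" "\<mu> + \<alpha> \<ge> 0" "\<mu> + \<beta> \<ge> 0" for \<mu> \<alpha> \<beta> n
    using c[OF that, of n] c[OF that, of 2] by (auto split: if_splits)
  have phi_0: "phi a b \<alpha> \<beta> \<mu> 0
      = rGamma (\<mu> + \<alpha>) * rGamma (\<mu> + \<beta>) - rGamma \<mu> * rGamma (\<mu> + \<alpha> + \<beta>)" for \<alpha> \<beta> \<mu>
    by (simp add: phi_def hyp_rGamma_0 add_ac mult_ac)

  show ?thesis
  proof (rule conjI; intro allI impI)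
    fix x :: real assume x: "0 \<le> x"
    show "strictly_log_concave_on {0<..} (\<lambda>\<nu>. hyp_rGamma a b \<nu> x)"
      unfolding strictly_log_concave_on_def
    proof (intro conjI allI impI ballI)
      show "continuous_on {0<..} (\<lambda>\<nu>. hyp_rGamma a b \<nu> x)" by (rule continuous_on_hyp_rGamma[OF ab])
    next
      fix \<nu> :: real assume "\<nu> \<in> {0<..}"
      then show "0 < hyp_rGamma a b \<nu> x"
        using hyp_rGamma_pos[OF ab, of \<nu> x] x by (cases "x = 0") (auto simp: hyp_rGamma_0 rGamma_real_pos)
    next
      fix \<mu> h :: real assume h: "0 < h" and "{\<mu>..\<mu> + 2 * h} \<subseteq> {0<..}"
      moreover have "\<mu> \<in> {\<mu>..\<mu> + 2 * h}" using h by simp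
      ultimately have \<mu>: "0 < \<mu>" by blast
      \<comment> \<open>Log-concavity is the case \<open>\<alpha> = \<beta> = h\<close>; for
        \<open>\<mu> > 0\<close> the constant coefficient is positive, which also covers
        \<open>x = 0\<close>.\<close>
      have "0 < ?c h h \<mu> 0" using c[of \<mu> h h 0] h \<mu> by (auto split: if_splits)
      then have "0 < phi a b h h \<mu> 0"
        using phi_sums[OF ab, of h h \<mu> 0] by (simp add: powser_sums_zero_iff)
      also have "\<dots> \<le> phi a b h h \<mu> x"
        using h \<mu> x by (intro power_series_nonneg_mono[OF phi_sums[OF ab]] c_nonneg) auto
      finally show "hyp_rGamma a b \<mu> x * hyp_rGamma a b (\<mu> + 2 * h) x < (hyp_rGamma a b (\<mu> + h) x)\<^sup>2"
        by (simp add: phi_def power2_eq_square add_ac mult_ac)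
    qed
  next
    fix \<mu> \<alpha> \<beta> :: real
    assume par: "\<mu> \<ge> -1" "\<alpha> > 0" "\<beta> > 0" "\<mu> + \<alpha> \<ge> 0" "\<mu> + \<beta> \<ge> 0"
    let ?\<phi> = "phi a b \<alpha> \<beta> \<mu>"
    note sums = phi_sums[OF ab, of \<alpha> \<beta> \<mu>]
    note nonneg = c_nonneg[OF par] and pos = c_pos[OF par]
    have coeffs: "\<exists>c :: nat \<Rightarrow> real. (\<forall>x. (\<lambda>n. c n * x ^ n) sums ?\<phi> x) \<and>
          (\<forall>n. if n = 0 \<and> \<mu> = -1 \<and> (\<alpha> = 1 \<or> \<beta> = 1) \<or>
                  n = 1 \<and> \<mu> + \<alpha> = 0 \<and> \<mu> + \<beta> = 0
               then c n = 0 else 0 < c n)"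
      using sums c[OF par] by (intro exI[of _ "?c \<alpha> \<beta> \<mu>"] conjI allI)
    have ratio: "\<forall>x\<ge>0.
          let lhs = Gamma_ext (\<alpha> + \<mu>) * Gamma_ext (\<beta> + \<mu>) / (Gamma_ext \<mu> * Gamma_ext (\<alpha> + \<beta> + \<mu>));
              ratio = ereal (hyp_rGamma a b \<mu> x * hyp_rGamma a b (\<alpha> + \<beta> + \<mu>) x) /
                      ereal (hyp_rGamma a b (\<alpha> + \<mu>) x * hyp_rGamma a b (\<beta> + \<mu>) x)
          in (if x = 0 then lhs = ratio else lhs < ratio) \<and> ratio < 1"
      (is "\<forall>x\<ge>0. ?P x")
    proof (intro allI impI)
      fix x :: real assume "0 \<le> x"
      then show "?P x"
        using hyp_rGamma_ratio_bounds_0[OF par] hyp_rGamma_ratio_bounds[OF ab par, of x]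
          power_series_pos[OF sums nonneg pos, of x]
        by (cases "x = 0") (simp_all add: hyp_rGamma_0 Let_def)
    qed
    have bound: "\<forall>x\<ge>0.
          ?\<phi> x \<ge> rGamma (\<mu> + \<alpha>) * rGamma (\<mu> + \<beta>) - rGamma \<mu> * rGamma (\<mu> + \<alpha> + \<beta>) \<and>
          (?\<phi> x = rGamma (\<mu> + \<alpha>) * rGamma (\<mu> + \<beta>) - rGamma \<mu> * rGamma (\<mu> + \<alpha> + \<beta>)
           \<longleftrightarrow> x = 0)"
      (is "\<forall>x\<ge>0. ?P x")
    proof (intro allI impI)
      fix x :: real assume "0 \<le> x"
      then show "?P x"
        unfolding phi_0[symmetric]
        using phi_strict_mono[OF ab nonneg pos, of x] by (cases "x = 0") auto
    qed
    note results = coeffs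
      power_series_absolutely_monotonic[OF sums nonneg]
      power_series_multiplicatively_convex[OF sums nonneg pos]
      power_series_inverse_completely_monotonic[OF sums nonneg]
      power_series_inverse_log_convex[OF sums nonneg pos]
      power_series_Laplace_measure[OF sums nonneg] ratio bound
    show "?S \<mu> \<alpha> \<beta>" by (intro conjI results)
  qed
qed

end
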